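(* For $w\in\mathfrak{h}_C^0$ and $m\geq1$, \[ \sum_{i=1}^{m}(-1)^{i-1}F(y^{i-1}\,\underline{\ast}\, w,\,m-i)=\partial_{m}(w), \] where for $v\in\mathfrak{h}_C^0$ and $n\ge0$, $F(v,n):=\{1\}_{\star}^{n}\,\underline{\ast}\,(y\,\underline{\sqcup\!\sqcup}\, v)-(n+1)\{1\}_{\star}^{n+1}\,\underline{\ast}\, v$.
   Context: $\mathfrak{h}=\mathbb{Q}\langle x,y\rangle$, $\mathfrak{h}_C=\mathfrak{h}x\oplus\mathfrak{h}y$, $\mathfrak{h}^0=\mathbb{Q}\oplus y\mathfrak{h}x$, $\mathfrak{h}^1=\mathbb{Q}\oplus y\mathfrak{h}$, $\mathfrak{h}_C^0=\mathfrak{h}^0\cap\mathfrak{h}_C$, $\mathfrak{h}_C^1=\mathfrak{h}^1\cap\mathfrak{h}_C$, $z_k=yx^{k-1}$, $y^0=1$. $\{1\}_\star^0:=1$ and $\{1\}_\star^n:=y(x+y)^{n-1}$ for $n>0$. $\partial_m$ is the derivation of $\mathfrak{h}$ with $\partial_{m}(x)=y(x+y)^{m-1}x$, $\partial_{m}(y)=-y(x+y)^{m-1}x$. Shuffle: bilinear on $\mathfrak{h}$ with $1\sqcup\!\sqcup w=w\sqcup\!\sqcup 1=w$, $uw\sqcup\!\sqcup u'w'=u(w\sqcup\!\sqcup u'w')+u'(uw\sqcup\!\sqcup w')$ ($u,u'\in\{x,y\}$). Inner shuffle $\underline{\sqcup\!\sqcup}:\mathfrak{h}\times\mathfrak{h}_C\to\mathfrak{h}_C$: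 bilinear with $w\,\underline{\sqcup\!\sqcup}\,x=w\,\underline{\sqcup\!\sqcup}\,y=0$, $w\,\underline{\sqcup\!\sqcup}\, uw'u'=u(w\sqcup\!\sqcup w')u'$ ($u,u'\in\{x,y\}$). Inner harmonic product $\underline{\ast}:\mathfrak{h}^1\times\mathfrak{h}_C^1\to\mathfrak{h}_C^1$: bilinear, with $1\,\underline{\ast}\,w=w$ and on words ($s\ge1$) $z_{k_{1}}\cdots z_{k_{r}}\,\underline{\ast}\, z_{l_{1}}\cdots z_{l_{s}}=\sum_{d=\max(r,s)}^{r+s}\sum_{(f,g)}z_{m_{1}}\cdots z_{m_{d}}$, over strictly increasing $f:\{1,\dots,r\}\to\{1,\dots,d\}$, $g:\{1,\dots,s\}\to\{1,\dots,d\}$ with $\mathrm{Im}f\cup\mathrm{Im}g=\{1,\dots,d\}$ and $g(1)\le f(i)\le g(s)$ for all $i$, where $m_i=k_{f^{-1}(i)}$ on $\mathrm{Im}f\setminus\mathrm{Im}g$, $m_i=l_{g^{-1}(i)}$ on $\mathrm{Im}g\setminus\mathrm{Im}f$, $m_i=k_{f^{-1}(i)}+l_{g^{-1}(i)}$ on $\mathrm{Im}f\cap\mathrm{Im}g$. *)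

theory Defs
  imports Complex_Main "HOL-Library.Poly_Mapping" "HOL-Library.FuncSet"
begin

datatype letter = LX | LY

text \<open>The free monoid is written additively so that the convolution product of
  finitely supported functions is concatenation of words; \<open>letter list \<Rightarrow>\<^sub>0 rat\<close> is then
  the ring of noncommutative polynomials in two variables.\<close>

instantiation list :: (type) monoid_add
begin

definition zero_list :: "'a list" where "zero_list = []"

definition plus_list :: "'a list \<Rightarrow> 'a list \<Rightarrow> 'a list" where "plus_list = (@)"

instance
  by standard (simp_all add: zero_list_def plus_list_def)

end

type_synonym word = "letter list"
type_synonym ncpoly = "word \<Rightarrow>\<^sub>0 rat"

definition mon :: "word \<Rightarrow> ncpoly" where
  "mon w = Poly_Mapping.single w 1"

definition const :: "rat \<Rightarrow> ncpoly" where
  "const c = Poly_Mapping.single [] c"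

definition hx :: ncpoly where "hx = mon [LX]"

definition hy :: ncpoly where "hy = mon [LY]"

definition hC :: "ncpoly set" where
  "hC = {a * hx + b * hy | a b. True}"

definition h0 :: "ncpoly set" where
  "h0 = {const c + hy * a * hx | c a. True}"

definition h1 :: "ncpoly set" where
  "h1 = {const c + hy * a | c a. True}"

definition hC0 :: "ncpoly set" where "hC0 = h0 \<inter> hC"

definition hC1 :: "ncpoly set" where "hC1 = h1 \<inter> hC"

definition linext :: "(word \<Rightarrow> ncpoly) \<Rightarrow> ncpoly \<Rightarrow> ncpoly" where
  "linext B p = (\<Sum>u\<in>Poly_Mapping.keys p. const (Poly_Mapping.lookup p u) * B u)"

definition bilinext :: "(word \<Rightarrow> word \<Rightarrow> ncpoly) \<Rightarrow> ncpoly \<Rightarrow> ncpoly \<Rightarrow> ncpoly" where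
  "bilinext B p q = linext (\<lambda>u. linext (B u) q) p"

fun shuffle_word :: "word \<Rightarrow> word \<Rightarrow> ncpoly" where
  "shuffle_word [] w = mon w"
| "shuffle_word w [] = mon w"
| "shuffle_word (u # w) (u' # w') =
     mon [u] * shuffle_word w (u' # w') + mon [u'] * shuffle_word (u # w) w'"

definition shuffle :: "ncpoly \<Rightarrow> ncpoly \<Rightarrow> ncpoly" where
  "shuffle = bilinext shuffle_word"

text \<open>The inner products below are total functions. The inner shuffle is only meaningful when
  its second argument is in \<open>hC\<close>, the inner harmonic product only on \<open>h1\<close> and \<open>hC1\<close>.\<close>

definition inner_shuffle_word :: "word \<Rightarrow> word \<Rightarrow> ncpoly" where
  "inner_shuffle_word w v =
     (if length v < 2 then 0
      else mon [hd v] * shuffle (mon w) (mon (butlast (tl v))) * mon [last v])"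

definition inner_shuffle :: "ncpoly \<Rightarrow> ncpoly \<Rightarrow> ncpoly" where
  "inner_shuffle = bilinext inner_shuffle_word"

definition z_word :: "nat list \<Rightarrow> word" where
  "z_word ks = concat (map (\<lambda>k. LY # replicate (k - 1) LX) ks)"

text \<open>The inverse of \<open>z_word\<close> on positive indices; unspecified on words beginning with \<open>LX\<close>.\<close>

definition z_index :: "word \<Rightarrow> nat list" where
  "z_index w = (THE ks. (\<forall>k\<in>set ks. 1 \<le> k) \<and> z_word ks = w)"

text \<open>Positions are counted from 0, so the map \<open>f\<close> lives on \<open>{..<r}\<close>, the map \<open>g\<close> on
  \<open>{..<s}\<close>, and the first and last values of \<open>g\<close> are \<open>g 0\<close> and \<open>g (s - 1)\<close>.\<close>

definition inner_pairs :: "nat \<Rightarrow> nat \<Rightarrow> nat \<Rightarrow> ((nat \<Rightarrow> nat) \<times> (nat \<Rightarrow> nat)) set" where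
  "inner_pairs r s d =
     {(f, g). f \<in> {..<r} \<rightarrow>\<^sub>E {..<d} \<and> g \<in> {..<s} \<rightarrow>\<^sub>E {..<d} \<and>
        strict_mono_on {..<r} f \<and> strict_mono_on {..<s} g \<and>
        f ` {..<r} \<union> g ` {..<s} = {..<d} \<and>
        (\<forall>i<r. g 0 \<le> f i \<and> f i \<le> g (s - 1))}"

definition merged_index ::
  "nat list \<Rightarrow> nat list \<Rightarrow> (nat \<Rightarrow> nat) \<Rightarrow> (nat \<Rightarrow> nat) \<Rightarrow> nat \<Rightarrow> nat" where
  "merged_index ks ls f g i =
     (let R = {..<length ks}; S = {..<length ls};
          k = ks ! inv_into R f i; l = ls ! inv_into S g i
      in if i \<in> f ` R - g ` S then k else if i \<in> g ` S - f ` R then l else k + l)"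

definition inner_harmonic_word :: "word \<Rightarrow> word \<Rightarrow> ncpoly" where
  "inner_harmonic_word u v =
     (if u = [] then mon v
      else let ks = z_index u; ls = z_index v; r = length ks; s = length ls
        in \<Sum>d\<in>{max r s..r + s}. \<Sum>(f, g)\<in>inner_pairs r s d.
             mon (z_word (map (merged_index ks ls f g) [0..<d])))"

definition inner_harmonic :: "ncpoly \<Rightarrow> ncpoly \<Rightarrow> ncpoly" where
  "inner_harmonic = bilinext inner_harmonic_word"

definition ones_star :: "nat \<Rightarrow> ncpoly" where
  "ones_star n = (if n = 0 then 1 else hy * (hx + hy) ^ (n - 1))"

definition derivation :: "(ncpoly \<Rightarrow> ncpoly) \<Rightarrow> bool" where
  "derivation D \<longleftrightarrow>
     (\<forall>p q. D (p + q) = D p + D q) \<and>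
     (\<forall>c p. D (const c * p) = const c * D p) \<and>
     (\<forall>p q. D (p * q) = D p * q + p * D q)"

definition partial_deriv :: "nat \<Rightarrow> ncpoly \<Rightarrow> ncpoly" where
  "partial_deriv m = (THE D. derivation D \<and>
     D hx = hy * (hx + hy) ^ (m - 1) * hx \<and>
     D hy = - (hy * (hx + hy) ^ (m - 1) * hx))"

definition F :: "ncpoly \<Rightarrow> nat \<Rightarrow> ncpoly" where
  "F v n = inner_harmonic (ones_star n) (inner_shuffle hy v)
           - of_nat (n + 1) * inner_harmonic (ones_star (n + 1)) v"


subsection \<open>Well-definedness\<close>

lemma mon_Nil: "mon [] = 1"
  by (simp add: mon_def zero_list_def flip: single_one)

lemma mon_append: "mon (u @ v) = mon u * mon v"
  by (simp add: mon_def mult_single plus_list_def)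

lemma const_times_single: "const c * Poly_Mapping.single w a = Poly_Mapping.single w (c * a)"
  by (simp add: const_def mult_single plus_list_def)

lemma const_mon: "const c * mon w = Poly_Mapping.single w c"
  by (simp add: mon_def const_times_single)

lemma const_add: "const (a + b) = const a + const b"
  by (simp add: const_def single_add)

lemma const_mult: "const (a * b) = const a * const b"
  by (simp add: const_def mult_single plus_list_def)

lemma const_0: "const 0 = 0"
  by (simp add: const_def)

lemma const_commute: "const c * p = p * const c"
proof (induction p rule: update_induct)
  case const
  show ?case by simp
next
  case (update p a b)
  have "Poly_Mapping.update a b p = p + Poly_Mapping.single a b"
    using update by (intro poly_mapping_eqI)
      (auto simp: lookup_update lookup_add lookup_single in_keys_iff when_def)
  with update.IH show ?case
    by (simp add: distrib_left distrib_right const_def mult_single plus_list_def mult.commute)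
qed

lemma const_one: "const 1 = 1"
  using mon_Nil by (simp add: mon_def const_def)

lemma linext_superset:
  assumes "finite A" "Poly_Mapping.keys p \<subseteq> A"
  shows "linext B p = (\<Sum>u\<in>A. const (Poly_Mapping.lookup p u) * B u)"
  unfolding linext_def using assms
  by (intro sum.mono_neutral_left) (auto simp: in_keys_iff const_0)

lemma linext_add: "linext B (p + q) = linext B p + linext B q"
proof -
  let ?A = "Poly_Mapping.keys p \<union> Poly_Mapping.keys q"
  have "Poly_Mapping.keys (p + q) \<subseteq> ?A" by (rule keys_add)
  then show ?thesis
    by (simp add: linext_superset[of ?A] lookup_add const_add distrib_right sum.distrib)
qed

lemma linext_single: "linext B (Poly_Mapping.single w c) = const c * B w"
  by (simp add: linext_def const_0)

lemma linext_mon: "linext B (mon w) = B w"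
  by (simp add: mon_def linext_single const_one)

lemma additive_eqI:
  fixes D E :: "ncpoly \<Rightarrow> ncpoly"
  assumes "\<And>p q. D (p + q) = D p + D q" "\<And>p q. E (p + q) = E p + E q"
    and "\<And>w c. D (Poly_Mapping.single w c) = E (Poly_Mapping.single w c)"
  shows "D p = E p"
proof (induction p rule: update_induct)
  case const
  show ?case using assms(3)[of "[]" 0] by simp
next
  case (update p a b)
  have "Poly_Mapping.update a b p = p + Poly_Mapping.single a b"
    using update by (intro poly_mapping_eqI)
      (auto simp: lookup_update lookup_add lookup_single in_keys_iff when_def)
  with update.IH show ?case by (simp add: assms)
qed

lemma linext_scale: "linext B (const c * p) = const c * linext B p"
  by (rule additive_eqI[of "\<lambda>p. linext B (const c * p)" "\<lambda>p. const c * linext B p"])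
    (simp_all add: distrib_left linext_add linext_single const_times_single const_mult mult.assoc)

lemma linext_add_fun: "linext (\<lambda>u. A u + B u) p = linext A p + linext B p"
  by (simp add: linext_def distrib_left sum.distrib)

lemma linext_scale_fun: "linext (\<lambda>u. const c * B u) p = const c * linext B p"
  unfolding linext_def sum_distrib_left
  by (rule sum.cong) (simp_all add: mult.commute flip: mult.assoc const_mult)

lemma bilinext_mon: "bilinext B (mon u) (mon v) = B u v"
  by (simp add: bilinext_def linext_mon)

lemma bilinext_bilinear:
  "bilinext B (p + p') q = bilinext B p q + bilinext B p' q"
  "bilinext B p (q + q') = bilinext B p q + bilinext B p q'"
  "bilinext B (const c * p) q = const c * bilinext B p q"
  "bilinext B p (const c * q) = const c * bilinext B p q"
  by (simp_all add: bilinext_def linext_add linext_scale linext_add_fun linext_scale_fun)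

lemma z_word_inj:
  assumes "\<forall>k\<in>set ks. 1 \<le> k" "\<forall>l\<in>set ls. 1 \<le> l" "z_word ks = z_word ls"
  shows "ks = ls"
  using assms
proof (induction ks arbitrary: ls)
  case Nil
  then show ?case by (cases ls) (auto simp: z_word_def)
next
  case (Cons k ks)
  obtain l ls' where ls: "ls = l # ls'"
    using Cons.prems by (cases ls) (auto simp: z_word_def)
  have len: "length (takeWhile ((=) LX) (replicate n LX @ z_word js)) = n" for n js
    by (induction n) (cases js; simp add: z_word_def)+
  have eq: "replicate (k - 1) LX @ z_word ks = replicate (l - 1) LX @ z_word ls'"
    using Cons.prems(3) by (simp add: ls z_word_def)
  then have "k - 1 = l - 1" using len by metis
  with Cons.prems(1,2) have "k = l" unfolding ls list.set by (metis insertI1 le_add_diff_inverse)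
  moreover have "ks = ls'"
    using Cons.prems(1,2) eq \<open>k = l\<close> by (intro Cons.IH) (simp_all add: ls)
  ultimately show ?case by (simp add: ls)
qed

lemma z_index_z_word:
  assumes "\<forall>k\<in>set ks. 1 \<le> k"
  shows "z_index (z_word ks) = ks"
  unfolding z_index_def using assms z_word_inj by (intro the_equality) auto

fun leibniz_word :: "(letter \<Rightarrow> ncpoly) \<Rightarrow> word \<Rightarrow> ncpoly" where
  "leibniz_word d [] = 0"
| "leibniz_word d (u # w) = d u * mon w + mon [u] * leibniz_word d w"

lemma leibniz_word_append:
  "leibniz_word d (u @ v) = leibniz_word d u * mon v + mon u * leibniz_word d v"
proof (induction u)
  case (Cons a u)
  have "mon (a # u) = mon [a] * mon u" using mon_append[of "[a]" u] by simp
  with Cons show ?case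
    by (simp add: mon_append distrib_left distrib_right mult.assoc add.assoc)
qed (simp add: mon_Nil)

lemma derivation_linext_leibniz: "derivation (linext (leibniz_word d))"
proof -
  let ?D = "linext (leibniz_word d)"
  have single: "Poly_Mapping.single w c = const c * mon w" for w c
    by (simp add: const_mon)
  have words: "?D (mon u * mon v) = ?D (mon u) * mon v + mon u * ?D (mon v)" for u v
    by (simp add: linext_mon leibniz_word_append flip: mon_append)
  have pull: "p * (const c * q) = const c * (p * q)" for c p q
    by (metis const_commute mult.assoc)
  have right: "?D (mon u * q) = ?D (mon u) * q + mon u * ?D q" for u q
    by (rule additive_eqI[of "\<lambda>q. ?D (mon u * q)" "\<lambda>q. ?D (mon u) * q + mon u * ?D q"])
      (simp_all add: distrib_left linext_add single pull linext_scale words)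
  have "?D (p * q) = ?D p * q + p * ?D q" for p q
    by (rule additive_eqI[of "\<lambda>p. ?D (p * q)" "\<lambda>p. ?D p * q + p * ?D q"])
      (simp_all add: distrib_right linext_add single mult.assoc linext_scale right distrib_left)
  then show ?thesis by (simp add: derivation_def linext_add linext_scale)
qed

lemma derivation_unique:
  assumes "derivation D" "derivation E" "D hx = E hx" "D hy = E hy"
  shows "D = E"
proof
  fix p
  have one: "G 1 = 0" if "derivation G" for G
  proof -
    have "G (1 * 1) = G 1 * 1 + 1 * G 1" using that unfolding derivation_def by blast
    then show ?thesis by simp
  qed
  have mon: "D (mon w) = E (mon w)" for w
  proof (induction w)
    case Nil
    show ?case using one[OF assms(1)] one[OF assms(2)] by (simp add: mon_Nil)
  next
    case (Cons a w)
    have "mon (a # w) = mon [a] * mon w" using mon_append[of "[a]" w] by simp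
    moreover have "D (mon [a]) = E (mon [a])"
      using assms(3,4) by (cases a) (simp_all add: hx_def hy_def)
    ultimately show ?case using Cons assms(1,2) by (simp add: derivation_def)
  qed
  show "D p = E p"
  proof (rule additive_eqI[of D E])
    fix w :: word and c :: rat
    have "G (Poly_Mapping.single w c) = const c * G (mon w)" if "derivation G" for G
      using that unfolding derivation_def by (metis const_mon)
    then show "D (Poly_Mapping.single w c) = E (Poly_Mapping.single w c)"
      using assms(1,2) mon by metis
  qed (use assms(1,2) in \<open>auto simp only: derivation_def\<close>)
qed

lemma partial_deriv:
  "derivation (partial_deriv m)"
  "partial_deriv m hx = hy * (hx + hy) ^ (m - 1) * hx"
  "partial_deriv m hy = - (hy * (hx + hy) ^ (m - 1) * hx)"
proof -
  let ?a = "hy * (hx + hy) ^ (m - 1) * hx"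
  let ?P = "\<lambda>D. derivation D \<and> D hx = ?a \<and> D hy = - ?a"
  have "?P (linext (leibniz_word (\<lambda>u. if u = LX then ?a else - ?a)))"
    by (simp add: derivation_linext_leibniz) (simp add: hx_def hy_def linext_mon mon_Nil)
  then have "\<exists>!D. ?P D" using derivation_unique by (intro ex1I) auto
  then have "?P (partial_deriv m)" unfolding partial_deriv_def by (rule theI')
  then show "derivation (partial_deriv m)" "partial_deriv m hx = ?a" "partial_deriv m hy = - ?a"
    by auto
qed

end

theory Submission
  imports Defs "HOL-Computational_Algebra.Formal_Power_Series"
begin

text \<open>
  Pass to power series over \<open>h\<close> in a central variable \<open>t\<close>, and write \<open>z = x + y\<close>, \<open>R = (1 - t z)\<^sup>-\<^sup>1\<close>,
  \<open>G = (1 - t x)\<^sup>-\<^sup>1\<close>. Inner harmonic multiplication by \<open>\<Sum> t\<^sup>n {1}\<^sub>\<star>\<^sup>n\<close> maps \<open>y a\<close> to \<open>y \<sigma>(a) G\<close>, where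
  \<open>\<sigma>\<close> is the algebra homomorphism \<open>x \<mapsto> x\<close>, \<open>y \<mapsto> R y\<close>; multiplication by \<open>\<Sum> (- t)\<^sup>n y\<^sup>n\<close> maps \<open>y a\<close>
  to \<open>y \<phi>(a) (1 - t x)\<close>, where \<open>\<phi>\<close> is the homomorphism \<open>x \<mapsto> x\<close>, \<open>y \<mapsto> (1 - t x) (1 + t y)\<^sup>-\<^sup>1 y\<close>.
  The homomorphisms \<open>\<sigma>\<close> and \<open>\<phi>\<close> are mutually inverse, hence so are the two multiplications.
  The inner shuffle with \<open>y\<close> maps \<open>y a\<close> to \<open>y \<delta>(a)\<close>, where \<open>\<delta>\<close> is the derivation \<open>u \<mapsto> y u\<close> on letters.
  With \<open>\<Delta> = \<Sum> t\<^sup>n \<partial>\<^sub>n\<^sub>+\<^sub>1\<close> and \<open>c = R x\<close>, comparing both sides on \<open>x\<close> and \<open>y\<close> gives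
  \<open>\<sigma>(\<delta> a) - d/dt \<sigma>(a) = \<Delta> \<sigma>(a) + \<sigma>(a) c - c \<sigma>(a)\<close>. This yields \<open>\<Sum> t\<^sup>n F(v, n) = \<Delta> (\<Sum> t\<^sup>n {1}\<^sub>\<star>\<^sup>n * v)\<close>
  for the inner harmonic product, and it remains to substitute \<open>\<Sum> (- t)\<^sup>n y\<^sup>n * w\<close> for \<open>v\<close>.
\<close>

unbundle fps_syntax

section \<open>The inner harmonic product as a recursion\<close>

definition first_count :: "(bool \<times> bool) list \<Rightarrow> nat" where
  "first_count p = length (filter fst p)"

definition second_count :: "(bool \<times> bool) list \<Rightarrow> nat" where
  "second_count p = length (filter snd p)"

lemma counts_simps [simp]:
  "first_count [] = 0" "second_count [] = 0"
  "first_count ((a, b) # p) = (if a then Suc (first_count p) else first_count p)"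
  "second_count ((a, b) # p) = (if b then Suc (second_count p) else second_count p)"
  by (simp_all add: first_count_def second_count_def)

text \<open>A pair \<open>(f, g)\<close> is encoded by the list whose entry at \<open>i\<close> records whether \<open>i\<close> is in the image
  of \<open>f\<close> and of \<open>g\<close>. The inner condition then says that the first and the last entry meet \<open>g\<close>;
  dropping it at the first entry gives the class of patterns closed under taking tails.\<close>

definition right_patterns :: "nat \<Rightarrow> nat \<Rightarrow> (bool \<times> bool) list set" where
  "right_patterns r s = {p. (\<forall>e\<in>set p. fst e \<or> snd e) \<and> first_count p = r \<and> second_count p = s
     \<and> (p \<noteq> [] \<longrightarrow> snd (last p))}"

definition inner_patterns :: "nat \<Rightarrow> nat \<Rightarrow> (bool \<times> bool) list set" where
  "inner_patterns r s = {p \<in> right_patterns r s. p \<noteq> [] \<longrightarrow> snd (hd p)}"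

text \<open>The index lists enter as total functions, so that using up an entry is composition with
  \<open>Suc\<close> and no bounds have to be carried along.\<close>

fun merge_pattern :: "(bool \<times> bool) list \<Rightarrow> (nat \<Rightarrow> nat) \<Rightarrow> (nat \<Rightarrow> nat) \<Rightarrow> nat list" where
  "merge_pattern [] k l = []"
| "merge_pattern ((a, b) # p) k l =
     (if \<not> b then k 0 else if \<not> a then l 0 else k 0 + l 0) #
     merge_pattern p (if a then k \<circ> Suc else k) (if b then l \<circ> Suc else l)"

text \<open>The last entry of a nonempty pattern meets \<open>g\<close>, so the second count is
  positive.\<close>

lemma right_patterns_0_right_Nil:
  assumes "p \<in> right_patterns r 0" shows "p = []"
proof (rule ccontr)
  assume "p \<noteq> []"
  then have "snd (last p)" "last p \<in> set p" using assms by (auto simp: right_patterns_def)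
  then show False
    using assms by (auto simp: right_patterns_def second_count_def filter_empty_conv)
qed

lemma Nil_in_right_patterns [simp]: "[] \<in> right_patterns r s \<longleftrightarrow> r = 0 \<and> s = 0"
  by (auto simp: right_patterns_def)

lemma Cons_in_right_patterns:
  "(a, b) # p \<in> right_patterns r s \<longleftrightarrow> (a \<or> b) \<and> (a \<longrightarrow> 0 < r) \<and> (b \<longrightarrow> 0 < s) \<and>
     (p = [] \<longrightarrow> b) \<and> p \<in> right_patterns (if a then r - 1 else r) (if b then s - 1 else s)"
  by (auto simp: right_patterns_def)

lemma right_patterns_0_right: "right_patterns r 0 = (if r = 0 then {[]} else {})"
proof (rule set_eqI)
  fix p show "p \<in> right_patterns r 0 \<longleftrightarrow> p \<in> (if r = 0 then {[]} else {})"
    by (cases "p = []") (auto dest: right_patterns_0_right_Nil)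
qed

lemma Cons_in_Cons_image: "x # xs \<in> (#) y ` A \<longleftrightarrow> x = y \<and> xs \<in> A"
  by auto

text \<open>The split is by the first entry. After \<open>(True, False)\<close> the tail still has
  to use \<open>Suc s\<close> entries of the second list, so it is nonempty and inherits the
  condition on the last entry.\<close>

lemma right_patterns_Suc_Suc:
  "right_patterns (Suc r) (Suc s) =
     (#) (True, False) ` right_patterns r (Suc s) \<union> (#) (False, True) ` right_patterns (Suc r) s
     \<union> (#) (True, True) ` right_patterns r s" (is "?L = ?R")
proof (rule set_eqI)
  fix p show "p \<in> ?L \<longleftrightarrow> p \<in> ?R"
  proof (cases p)
    case (Cons e q)
    obtain a b where "e = (a, b)" by (cases e)
    with Cons show ?thesis
      by (cases a; cases b) (auto simp: Cons_in_right_patterns Cons_in_Cons_image)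
  qed auto
qed

lemma right_patterns_0_Suc: "right_patterns 0 (Suc s) = (#) (False, True) ` right_patterns 0 s"
  (is "?L = ?R")
proof (rule set_eqI)
  fix p show "p \<in> ?L \<longleftrightarrow> p \<in> ?R"
  proof (cases p)
    case (Cons e q)
    obtain a b where "e = (a, b)" by (cases e)
    with Cons show ?thesis
      by (cases a; cases b) (auto simp: Cons_in_right_patterns Cons_in_Cons_image)
  qed auto
qed

lemma inner_patterns_Suc:
  "inner_patterns r (Suc s) = (#) (False, True) ` right_patterns r s \<union>
     (case r of 0 \<Rightarrow> {} | Suc r' \<Rightarrow> (#) (True, True) ` right_patterns r' s)" (is "?L = ?R")
proof (rule set_eqI)
  fix p show "p \<in> ?L \<longleftrightarrow> p \<in> ?R"
  proof (cases p)
    case (Cons e q)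
    obtain a b where "e = (a, b)" by (cases e)
    with Cons show ?thesis
      by (cases a; cases b; cases r)
        (auto simp: inner_patterns_def Cons_in_right_patterns Cons_in_Cons_image)
  qed (auto simp: inner_patterns_def split: nat.splits)
qed

lemma finite_right_patterns: "finite (right_patterns r s)"
proof (induction "r + s" arbitrary: r s rule: less_induct)
  case less
  then show ?case
    by (cases r; cases s)
      (simp_all add: right_patterns_0_right right_patterns_0_Suc right_patterns_Suc_Suc)
qed

text \<open>The quasi-shuffle product restricted to terms whose last letter involves an entry of the
  second list; hence the value 0 when that list runs out first.\<close>

fun tail_stuffle :: "nat list \<Rightarrow> nat list \<Rightarrow> ncpoly" where
  "tail_stuffle [] ls = mon (z_word ls)"
| "tail_stuffle (k # ks) [] = 0"
| "tail_stuffle (k # ks) (l # ls) =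
     mon (z_word [k]) * tail_stuffle ks (l # ls) + mon (z_word [l]) * tail_stuffle (k # ks) ls
     + mon (z_word [k + l]) * tail_stuffle ks ls"

lemma mon_z_word_Cons: "mon (z_word (k # ks)) = mon (z_word [k]) * mon (z_word ks)"
  by (simp add: z_word_def flip: mon_append)

lemma sum_Cons_image: "sum g ((#) e ` A) = (\<Sum>p\<in>A. g (e # p))"
  by (simp add: sum.reindex)

lemma Cons_images_disjoint: "a \<noteq> b \<Longrightarrow> (#) a ` A \<inter> (#) b ` B = {}"
  by auto

lemma nth_Cons_comp_Suc: "(!) (x # xs) \<circ> Suc = (!) xs"
  by auto

lemma sum_right_patterns:
  "(\<Sum>p\<in>right_patterns (length ks) (length ls). mon (z_word (merge_pattern p ((!) ks) ((!) ls))))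
     = tail_stuffle ks ls"
proof (induction ks ls rule: tail_stuffle.induct)
  case (1 ls)
  show ?case
  proof (induction ls)
    case (Cons l ls)
    then show ?case
      by (simp add: right_patterns_0_Suc sum_Cons_image nth_Cons_comp_Suc mon_z_word_Cons[of l ls]
          mon_z_word_Cons[of _ "merge_pattern _ _ _"] flip: sum_distrib_left)
  qed (simp add: right_patterns_0_right)
next
  case (2 k ks)
  then show ?case by (simp add: right_patterns_0_right)
next
  case (3 k ks l ls)
  then show ?case
    by (simp add: right_patterns_Suc_Suc sum.union_disjoint finite_right_patterns
        Cons_images_disjoint Int_Un_distrib2 sum_Cons_image nth_Cons_comp_Suc
        mon_z_word_Cons[of _ "merge_pattern _ _ _"] flip: sum_distrib_left)
qed

text \<open>The first entry of an inner pattern has to use \<open>l\<close>, alone or merged with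
  the first entry of \<open>ks\<close>; behind it only the condition on the last entry
  remains.\<close>

lemma sum_inner_patterns:
  "(\<Sum>p\<in>inner_patterns (length ks) (length (l # ls)).
      mon (z_word (merge_pattern p ((!) ks) ((!) (l # ls)))))
     = mon (z_word [l]) * tail_stuffle ks ls +
       (case ks of [] \<Rightarrow> 0 | k # ks' \<Rightarrow> mon (z_word [k + l]) * tail_stuffle ks' ls)"
  using sum_right_patterns[of ks ls]
  by (cases ks)
    (simp_all add: inner_patterns_Suc sum.union_disjoint finite_right_patterns
        Cons_images_disjoint sum_Cons_image nth_Cons_comp_Suc sum_right_patterns
        mon_z_word_Cons[of _ "merge_pattern _ _ _"] flip: sum_distrib_left)

section \<open>Increasing maps and the bijection between pairs and patterns\<close>

lemma strict_mono_on_enumerates: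
  fixes f :: "nat \<Rightarrow> nat"
  assumes "strict_mono_on {..<r} f" "i < r"
  shows "f i = sorted_list_of_set (f ` {..<r}) ! i"
proof -
  have "sorted_wrt (<) (map f [0..<r])"
    using assms(1) by (auto simp: sorted_wrt_iff_nth_less strict_mono_on_def)
  moreover have "set (map f [0..<r]) = f ` {..<r}" by auto
  ultimately have "sorted_list_of_set (f ` {..<r}) = map f [0..<r]"
    by (metis strict_sorted_iff sorted_list_of_set.idem_if_sorted_distinct)
  then show ?thesis using assms(2) by simp
qed

text \<open>For increasing \<open>f\<close> the preimage of \<open>i\<close> counts the image points
  below \<open>i\<close>; this is also the number of entries that a pattern has used up before
  position \<open>i\<close>.\<close>

lemma inv_into_strict_mono_on:
  fixes f :: "nat \<Rightarrow> nat"
  assumes "strict_mono_on {..<r} f" "i \<in> f ` {..<r}"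
  shows "inv_into {..<r} f i = card {j \<in> f ` {..<r}. j < i}"
proof -
  obtain n where n: "n < r" "i = f n" using assms(2) by auto
  have inj: "inj_on f {..<r}" using assms(1) by (rule strict_mono_on_imp_inj_on)
  have "f j < f n \<longleftrightarrow> j < n" if "j < r" for j
    using that n(1) strict_mono_on_less[OF assms(1)] by simp
  then have "{j \<in> f ` {..<r}. j < i} = f ` {..<n}" using n by fastforce
  moreover have "card (f ` {..<n}) = n"
    using inj_on_subset[OF inj, of "{..<n}"] n by (simp add: card_image)
  ultimately show ?thesis using n inj by simp
qed

definition pair_pattern ::
  "nat \<Rightarrow> nat \<Rightarrow> nat \<Rightarrow> (nat \<Rightarrow> nat) \<times> (nat \<Rightarrow> nat) \<Rightarrow> (bool \<times> bool) list" where
  "pair_pattern r s d = (\<lambda>(f, g). map (\<lambda>i. (i \<in> f ` {..<r}, i \<in> g ` {..<s})) [0..<d])"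

lemma merge_pattern_nth:
  assumes "i < length p"
  shows "merge_pattern p k l ! i =
    (let a = k (first_count (take i p)); b = l (second_count (take i p))
     in if \<not> snd (p ! i) then a else if \<not> fst (p ! i) then b else a + b)"
  using assms
proof (induction p k l arbitrary: i rule: merge_pattern.induct)
  case (2 a b p k l)
  then show ?case by (cases i) (auto simp: Let_def)
qed simp

lemma length_merge_pattern: "length (merge_pattern p k l) = length p"
  by (induction p k l rule: merge_pattern.induct) auto

lemma length_filter_upt: "length (filter P [0..<n]) = card {j. j < n \<and> P j}"
  by (auto simp: length_filter_conv_card intro!: arg_cong[where f = card])

lemma map_merged_index:
  assumes "(f, g) \<in> inner_pairs (length ks) (length ls) d"
  shows "map (merged_index ks ls f g) [0..<d] =
    merge_pattern (pair_pattern (length ks) (length ls) d (f, g)) ((!) ks) ((!) ls)"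
proof (rule nth_equalityI)
  fix i assume "i < length (map (merged_index ks ls f g) [0..<d])"
  then have i: "i < d" by simp
  let ?I = "f ` {..<length ks}" and ?J = "g ` {..<length ls}"
  have mono: "strict_mono_on {..<length ks} f" "strict_mono_on {..<length ls} g"
    and cover: "?I \<union> ?J = {..<d}"
    using assms by (auto simp: inner_pairs_def)
  have "first_count (take i (pair_pattern (length ks) (length ls) d (f, g))) = card {j \<in> ?I. j < i}"
    using i by (auto simp: first_count_def pair_pattern_def take_map filter_map length_filter_upt
        intro!: arg_cong[where f = card])
  moreover
  have "second_count (take i (pair_pattern (length ks) (length ls) d (f, g))) = card {j \<in> ?J. j < i}"
    using i by (auto simp: second_count_def pair_pattern_def take_map filter_map length_filter_upt
        intro!: arg_cong[where f = card])
  ultimately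
  have "merge_pattern (pair_pattern (length ks) (length ls) d (f, g)) ((!) ks) ((!) ls) ! i =
    (let a = ks ! card {j \<in> ?I. j < i}; b = ls ! card {j \<in> ?J. j < i}
     in if i \<notin> ?J then a else if i \<notin> ?I then b else a + b)"
    using i by (subst merge_pattern_nth) (simp_all add: pair_pattern_def Let_def)
  \<comment> \<open>Off both images the two sides could differ: \<open>merged_index\<close> returns
    a sum there and \<open>merge_pattern\<close> an entry of \<open>ks\<close>. The covering
    condition excludes this case.\<close>
  moreover have "i \<in> ?I \<union> ?J" using i cover by simp
  ultimately show "map (merged_index ks ls f g) [0..<d] ! i =
    merge_pattern (pair_pattern (length ks) (length ls) d (f, g)) ((!) ks) ((!) ls) ! i"
    using i inv_into_strict_mono_on[OF mono(1), of i] inv_into_strict_mono_on[OF mono(2), of i]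
    by (auto simp: merged_index_def Let_def simp del: image_eqI)
qed (simp add: length_merge_pattern pair_pattern_def)

lemma pair_pattern_inj: "inj_on (pair_pattern r s d) (inner_pairs r s d)"
proof (rule inj_onI, clarify)
  fix f g f' g'
  assume A: "(f, g) \<in> inner_pairs r s d" "(f', g') \<in> inner_pairs r s d"
    and eq: "pair_pattern r s d (f, g) = pair_pattern r s d (f', g')"
  have mem: "i \<in> f ` {..<r} \<longleftrightarrow> i \<in> f' ` {..<r}"
    "i \<in> g ` {..<s} \<longleftrightarrow> i \<in> g' ` {..<s}" if "i < d" for i
    using that arg_cong[OF eq, of "\<lambda>p. p ! i"] by (simp_all add: pair_pattern_def)
  have sub: "f ` {..<r} \<subseteq> {..<d}" "f' ` {..<r} \<subseteq> {..<d}"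
    "g ` {..<s} \<subseteq> {..<d}" "g' ` {..<s} \<subseteq> {..<d}"
    using A by (auto simp: inner_pairs_def)
  have I: "f ` {..<r} = f' ` {..<r}"
    using mem(1) sub(1,2) by (intro set_eqI) (meson lessThan_iff subsetD)
  have J: "g ` {..<s} = g' ` {..<s}"
    using mem(2) sub(3,4) by (intro set_eqI) (meson lessThan_iff subsetD)
  \<comment> \<open>Increasing maps with the same image agree on their domain, and extensionality
    settles the remaining arguments.\<close>
  have "f = f'"
  proof
    fix i
    show "f i = f' i"
      using A I strict_mono_on_enumerates[of r f i] strict_mono_on_enumerates[of r f' i]
      by (cases "i < r") (auto simp: inner_pairs_def PiE_def extensional_def)
  qed
  moreover have "g = g'"
  proof
    fix i
    show "g i = g' i"
      using A J strict_mono_on_enumerates[of s g i] strict_mono_on_enumerates[of s g' i]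
      by (cases "i < s") (auto simp: inner_pairs_def PiE_def extensional_def)
  qed
  ultimately show "f = f' \<and> g = g'" by simp
qed

lemma exists_enumeration:
  assumes "I \<subseteq> {..<d::nat}" "card I = r"
  obtains f where "f \<in> {..<r} \<rightarrow>\<^sub>E {..<d}" "strict_mono_on {..<r} f" "f ` {..<r} = I"
proof
  have fin: "finite I" using assms(1) finite_subset by blast
  let ?f = "\<lambda>i\<in>{..<r}. sorted_list_of_set I ! i"
  have len: "length (sorted_list_of_set I) = r" using assms(2) by simp
  show image: "?f ` {..<r} = I"
  proof -
    have "?f ` {..<r} = set (sorted_list_of_set I)"
      unfolding set_conv_nth len by auto
    then show ?thesis using fin by simp
  qed
  show "?f \<in> {..<r} \<rightarrow>\<^sub>E {..<d}" using image assms(1) by (intro PiE_I) auto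
  have "sorted_wrt (<) (sorted_list_of_set I)" by simp
  then show "strict_mono_on {..<r} ?f"
    using len by (auto simp: strict_mono_on_def sorted_wrt_iff_nth_less)
qed

text \<open>The images cover, so 0 lies in one of them. If 0 is a value of \<open>f\<close> and
  \<open>g 0\<close> bounds these values from below, then \<open>g 0 = 0\<close>. Conversely, by
  monotonicity \<open>g\<close> can reach 0 only at 0.\<close>

lemma first_in_range_iff:
  fixes f g :: "nat \<Rightarrow> nat"
  assumes "f ` {..<r} \<union> g ` {..<s} = {..<d}" "strict_mono_on {..<s} g" "0 < s"
  shows "(\<forall>i<r. g 0 \<le> f i) \<longleftrightarrow> 0 \<in> g ` {..<s}"
proof
  have g0: "g 0 \<in> {..<d}" using assms(1,3) by blast
  assume L: "\<forall>i<r. g 0 \<le> f i"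
  have "0 \<in> f ` {..<r} \<union> g ` {..<s}" unfolding assms(1) using g0 by auto
  then show "0 \<in> g ` {..<s}" using L assms(3) by fastforce
next
  assume "0 \<in> g ` {..<s}"
  then obtain j where j: "j < s" "g j = 0" by auto
  then have "j = 0" using strict_mono_onD[OF assms(2), of 0 j] assms(3) by (metis lessThan_iff not_gr0 not_less0)
  then show "\<forall>i<r. g 0 \<le> f i" using j by simp
qed

lemma last_in_range_iff:
  fixes f g :: "nat \<Rightarrow> nat"
  assumes "f ` {..<r} \<union> g ` {..<s} = {..<d}" "strict_mono_on {..<s} g" "0 < s"
  shows "(\<forall>i<r. f i \<le> g (s - 1)) \<longleftrightarrow> d - 1 \<in> g ` {..<s}"
proof
  have g0: "g (s - 1) \<in> {..<d}" unfolding assms(1)[symmetric] using assms(3) by (intro UnI2 imageI) simp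
  assume L: "\<forall>i<r. f i \<le> g (s - 1)"
  have "d - 1 \<in> f ` {..<r} \<union> g ` {..<s}" unfolding assms(1) using g0 by auto
  moreover have "d - 1 \<in> g ` {..<s}" if "d - 1 = f i" "i < r" for i
  proof -
    have "g (s - 1) = d - 1" using L that g0 by fastforce
    then show ?thesis using assms(3) by (metis diff_less imageI lessThan_iff zero_less_one)
  qed
  ultimately show "d - 1 \<in> g ` {..<s}" by blast
next
  assume "d - 1 \<in> g ` {..<s}"
  then obtain j where j: "j < s" "g j = d - 1" by auto
  have "g j \<le> g (s - 1)"
    using strict_mono_onD[OF assms(2), of j "s - 1"] j(1) by (cases "j = s - 1") fastforce+
  moreover have "f i < d" if "i < r" for i using assms(1) that by blast
  ultimately show "\<forall>i<r. f i \<le> g (s - 1)" using j by fastforce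
qed

lemma pair_pattern_in_inner_patterns:
  assumes "f ` {..<r} \<union> g ` {..<s} = {..<d}" "strict_mono_on {..<r} f" "strict_mono_on {..<s} g" "0 < s"
  shows "pair_pattern r s d (f, g) \<in> inner_patterns r s \<longleftrightarrow> (\<forall>i<r. g 0 \<le> f i \<and> f i \<le> g (s - 1))"
proof -
  have d: "0 < d" using assms(1,4) by (metis Un_iff gr0I imageI lessThan_0 lessThan_iff empty_iff)
  have sub: "f ` {..<r} \<subseteq> {..<d}" "g ` {..<s} \<subseteq> {..<d}" using assms(1) by blast+
  have cover: "i \<in> f ` {..<r} \<or> i \<in> g ` {..<s}" if "i < d" for i
    using that unfolding Un_iff[symmetric] assms(1) by simp
  have "first_count (pair_pattern r s d (f, g)) = card (f ` {..<r})"
    using sub by (auto simp: first_count_def pair_pattern_def filter_map length_filter_upt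
        intro!: arg_cong[where f = card])
  moreover have "second_count (pair_pattern r s d (f, g)) = card (g ` {..<s})"
    using sub by (auto simp: second_count_def pair_pattern_def filter_map length_filter_upt
        intro!: arg_cong[where f = card])
  moreover have "card (f ` {..<r}) = r" "card (g ` {..<s}) = s"
    using assms(2,3)[THEN strict_mono_on_imp_inj_on] by (simp_all add: card_image)
  moreover have "\<forall>e\<in>set (pair_pattern r s d (f, g)). fst e \<or> snd e"
    using cover by (simp add: pair_pattern_def)
  moreover have "hd (pair_pattern r s d (f, g)) = (0 \<in> f ` {..<r}, 0 \<in> g ` {..<s})"
    "last (pair_pattern r s d (f, g)) = (d - 1 \<in> f ` {..<r}, d - 1 \<in> g ` {..<s})"
    "pair_pattern r s d (f, g) \<noteq> []"
    using d by (simp_all add: pair_pattern_def hd_map last_map)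
  ultimately show ?thesis
    using first_in_range_iff[OF assms(1,3,4)] last_in_range_iff[OF assms(1,3,4)]
    by (simp add: inner_patterns_def right_patterns_def) blast
qed

lemma pair_pattern_image:
  assumes "0 < s"
  shows "pair_pattern r s d ` inner_pairs r s d = {p \<in> inner_patterns r s. length p = d}"
proof (intro equalityI subsetI)
  fix p assume "p \<in> pair_pattern r s d ` inner_pairs r s d"
  then obtain f g where "(f, g) \<in> inner_pairs r s d" "p = pair_pattern r s d (f, g)" by auto
  then show "p \<in> {p \<in> inner_patterns r s. length p = d}"
    using pair_pattern_in_inner_patterns[of f r g s d] assms
    by (auto simp: inner_pairs_def pair_pattern_def)
next
  fix p assume p: "p \<in> {p \<in> inner_patterns r s. length p = d}"
  let ?I = "{i. i < d \<and> fst (p ! i)}" and ?J = "{i. i < d \<and> snd (p ! i)}"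
  have "card ?I = r" "card ?J = s"
    using p by (auto simp: inner_patterns_def right_patterns_def first_count_def second_count_def
        length_filter_conv_card)
  \<comment> \<open>For surjectivity, \<open>f\<close> and \<open>g\<close> enumerate the positions
    marked in the first and in the second component.\<close>
  then obtain f g where f: "f \<in> {..<r} \<rightarrow>\<^sub>E {..<d}" "strict_mono_on {..<r} f" "f ` {..<r} = ?I"
    and g: "g \<in> {..<s} \<rightarrow>\<^sub>E {..<d}" "strict_mono_on {..<s} g" "g ` {..<s} = ?J"
    using exists_enumeration[of ?I d r] exists_enumeration[of ?J d s]
    by (metis (no_types, lifting) lessThan_iff mem_Collect_eq subsetI)
  have "p = pair_pattern r s d (f, g)"
    using p f(3) g(3) by (auto intro!: nth_equalityI simp: pair_pattern_def)
  moreover have cover: "f ` {..<r} \<union> g ` {..<s} = {..<d}"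
    unfolding f(3) g(3) using p by (auto simp: inner_patterns_def right_patterns_def)
  moreover have "(f, g) \<in> inner_pairs r s d"
    using pair_pattern_in_inner_patterns[OF cover f(2) g(2) assms] p f g cover calculation(1)
    by (auto simp: inner_pairs_def)
  ultimately show "p \<in> pair_pattern r s d ` inner_pairs r s d" by blast
qed

text \<open>The bounds on \<open>d\<close> in the inner harmonic product exclude no pattern, so its
  double sum regroups into one sum over patterns.\<close>

lemma length_inner_patterns:
  assumes "p \<in> inner_patterns r s"
  shows "length p \<in> {max r s..r + s}"
proof -
  have "\<forall>e\<in>set p. fst e \<or> snd e \<Longrightarrow> length p \<le> first_count p + second_count p" for p
    by (induction p) (auto simp: first_count_def second_count_def)
  then show ?thesis
    using assms by (auto simp: inner_patterns_def right_patterns_def first_count_def second_count_def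
        intro: order_trans[OF length_filter_le])
qed

lemma finite_inner_patterns: "finite (inner_patterns r s)"
  by (simp add: inner_patterns_def finite_right_patterns)

lemma inner_harmonic_word_z_word:
  assumes "\<forall>k\<in>set ks. 1 \<le> k" "\<forall>k\<in>set (l # ls). 1 \<le> k"
  shows "inner_harmonic_word (z_word ks) (z_word (l # ls)) =
    mon (z_word [l]) * tail_stuffle ks ls +
    (case ks of [] \<Rightarrow> 0 | k # ks' \<Rightarrow> mon (z_word [k + l]) * tail_stuffle ks' ls)"
proof (cases ks)
  case Nil
  then show ?thesis
    by (simp add: inner_harmonic_word_def mon_z_word_Cons[of l ls]) (simp add: z_word_def)
next
  case (Cons k ks')
  let ?r = "length ks" and ?s = "length (l # ls)"
  let ?m = "\<lambda>p. mon (z_word (merge_pattern p ((!) ks) ((!) (l # ls))))"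
  have "z_word ks \<noteq> []" using Cons by (simp add: z_word_def)
  then have "inner_harmonic_word (z_word ks) (z_word (l # ls)) =
      (\<Sum>d\<in>{max ?r ?s..?r + ?s}. \<Sum>(f, g)\<in>inner_pairs ?r ?s d.
             mon (z_word (map (merged_index ks (l # ls) f g) [0..<d])))"
    unfolding inner_harmonic_word_def z_index_z_word[OF assms(1)] z_index_z_word[OF assms(2)] Let_def
    by (simp only: if_False)
  also have "\<dots> = (\<Sum>d\<in>{max ?r ?s..?r + ?s}. \<Sum>fg\<in>inner_pairs ?r ?s d. ?m (pair_pattern ?r ?s d fg))"
    by (intro sum.cong refl) (clarify, simp only: prod.case map_merged_index)
  also have "\<dots> = (\<Sum>d\<in>{max ?r ?s..?r + ?s}. \<Sum>p\<in>{p \<in> inner_patterns ?r ?s. length p = d}. ?m p)"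
    by (intro sum.cong refl) (simp add: pair_pattern_inj sum.reindex flip: pair_pattern_image)
  also have "\<dots> = (\<Sum>p\<in>inner_patterns ?r ?s. ?m p)"
    using length_inner_patterns[of _ ?r ?s]
    by (intro sum.group image_subsetI) (simp_all add: finite_inner_patterns)
  finally show ?thesis by (simp only: sum_inner_patterns)
qed

section \<open>Power series over the free algebra\<close>

lemma ncpoly_induct [case_names zero mon add]:
  assumes "P 0" "\<And>c w. P (const c * mon w)" "\<And>p q. P p \<Longrightarrow> P q \<Longrightarrow> P (p + q)"
  shows "P (p :: ncpoly)"
proof (induction p rule: update_induct)
  case const
  show ?case by (rule assms)
next
  case (update p a b)
  have "Poly_Mapping.update a b p = p + const b * mon a"
    using update by (intro poly_mapping_eqI)
      (auto simp: const_mon lookup_update lookup_add lookup_single in_keys_iff when_def)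
  with update.IH show ?case by (simp add: assms)
qed

definition fps_lift :: "(word \<Rightarrow> ncpoly fps) \<Rightarrow> ncpoly \<Rightarrow> ncpoly fps" where
  "fps_lift B p = Abs_fps (\<lambda>n. linext (\<lambda>u. B u $ n) p)"

lemma linext_0: "linext B 0 = 0"
  by (simp add: linext_def)

lemma fps_lift_0: "fps_lift B 0 = 0"
  by (simp add: fps_lift_def linext_0 fps_eq_iff)

lemma fps_lift_add: "fps_lift B (p + q) = fps_lift B p + fps_lift B q"
  by (simp add: fps_lift_def linext_add fps_eq_iff)

lemma fps_lift_scale: "fps_lift B (const c * p) = fps_const (const c) * fps_lift B p"
  by (simp add: fps_lift_def linext_scale fps_eq_iff)

lemma fps_lift_mon: "fps_lift B (mon w) = B w"
  by (simp add: fps_lift_def linext_mon fps_eq_iff)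

lemma mult_const_left_commute: "p * (const c * q) = const c * (p * q)"
  by (metis const_commute mult.assoc)

lemma fps_const_const_commute: "f * fps_const (const c) = fps_const (const c) * f"
  by (simp add: fps_eq_iff const_commute)

lemma fps_const_const_left_commute:
  "f * (fps_const (const c) * g) = fps_const (const c) * (f * g)"
  by (metis fps_const_const_commute mult.assoc)

definition fps_hom :: "(letter \<Rightarrow> ncpoly fps) \<Rightarrow> ncpoly \<Rightarrow> ncpoly fps" where
  "fps_hom h = fps_lift (\<lambda>u. prod_list (map h u))"

lemma fps_hom_linear:
  "fps_hom h 0 = 0" "fps_hom h (p + q) = fps_hom h p + fps_hom h q"
  "fps_hom h (const c * p) = fps_const (const c) * fps_hom h p"
  by (simp_all add: fps_hom_def fps_lift_0 fps_lift_add fps_lift_scale)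

lemma fps_hom_mon: "fps_hom h (mon w) = prod_list (map h w)"
  by (simp add: fps_hom_def fps_lift_mon)

lemma fps_hom_1: "fps_hom h 1 = 1"
  by (simp add: fps_hom_mon flip: mon_Nil)

lemma fps_hom_letters: "fps_hom h hx = h LX" "fps_hom h hy = h LY"
  by (simp_all add: hx_def hy_def fps_hom_mon)

lemma fps_hom_mult: "fps_hom h (p * q) = fps_hom h p * fps_hom h q"
proof (induction p rule: ncpoly_induct)
  case (mon c u)
  have "fps_hom h (mon u * q) = fps_hom h (mon u) * fps_hom h q"
    by (induction q rule: ncpoly_induct)
      (simp_all add: fps_hom_linear distrib_left mult_const_left_commute
        fps_const_const_left_commute fps_hom_mon flip: mon_append)
  then show ?case by (simp add: fps_hom_linear mult.assoc)
qed (simp_all add: fps_hom_linear distrib_right)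

text \<open>The extension of a linear \<open>A\<close> to series by linearity in \<open>t\<close>:
  each coefficient is mapped by \<open>A\<close> and its image is shifted by the degree of that
  coefficient.\<close>

definition fps_extend :: "(ncpoly \<Rightarrow> ncpoly fps) \<Rightarrow> ncpoly fps \<Rightarrow> ncpoly fps" where
  "fps_extend A f = Abs_fps (\<lambda>n. \<Sum>k=0..n. A (f $ k) $ (n - k))"

lemma fps_extend_add:
  assumes "\<And>p q. A (p + q) = A p + A q"
  shows "fps_extend A (f + g) = fps_extend A f + fps_extend A g"
  by (simp add: fps_extend_def fps_eq_iff assms sum.distrib)

lemma additive_sum:
  fixes A :: "'a::ab_group_add \<Rightarrow> 'b::ab_group_add"
  assumes "\<And>p q. A (p + q) = A p + A q"
  shows "A 0 = 0" "A (- p) = - A p" "A (sum f I) = (\<Sum>i\<in>I. A (f i))"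
proof -
  show 0: "A 0 = 0" using assms[of 0 0] by simp
  show "A (- p) = - A p" using assms[of p "- p"] 0 by (simp add: eq_neg_iff_add_eq_0 add.commute)
  show "A (sum f I) = (\<Sum>i\<in>I. A (f i))"
    by (induction I rule: infinite_finite_induct) (simp_all add: 0 assms)
qed

lemma fps_extend_minus:
  assumes "\<And>p q. A (p + q) = A p + A q"
  shows "fps_extend A (- f) = - fps_extend A f"
  using fps_extend_add[of A, OF assms] by (rule additive_sum(2))

lemma fps_extend_const:
  assumes "\<And>p q. A (p + q) = A p + A q"
  shows "fps_extend A (fps_const p) = A p"
proof (rule fps_ext)
  fix n
  have "fps_extend A (fps_const p) $ n = (\<Sum>k=0..n. if k = 0 then A p $ n else 0)"
    unfolding fps_extend_def fps_nth_Abs_fps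
    by (rule sum.cong) (auto simp: additive_sum(1)[of A, OF assms])
  then show "fps_extend A (fps_const p) $ n = A p $ n" by simp
qed

lemma fps_extend_fps_X:
  assumes "\<And>p q. A (p + q) = A p + A q"
  shows "fps_extend A (fps_X * f) = fps_X * fps_extend A f"
proof (rule fps_ext)
  fix n
  show "fps_extend A (fps_X * f) $ n = (fps_X * fps_extend A f) $ n"
    unfolding fps_extend_def fps_nth_Abs_fps
    by (cases n) (simp_all add: additive_sum(1)[of A, OF assms] sum.atLeast0_atMost_Suc_shift
      del: sum.cl_ivl_Suc)
qed

text \<open>Two summands let one computation serve both for homomorphisms, where the second is zero,
  and for derivations.\<close>

lemma fps_extend_mult:
  assumes add: "\<And>p q. A (p + q) = A p + A q"
    and mult: "\<And>p q. A (p * q) = B p * C q + B' p * C' q"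
  shows "fps_extend A (f * g) = fps_extend B f * fps_extend C g + fps_extend B' f * fps_extend C' g"
proof (rule fps_ext)
  fix n
  have rearrange: "(\<Sum>k=0..n. \<Sum>i=0..k. (B (f$i) * C (g$(k-i))) $ (n-k))
      = (fps_extend B f * fps_extend C g) $ n" for B C
  proof -
    have "(\<Sum>k=0..n. \<Sum>i=0..k. (B (f$i) * C (g$(k-i))) $ (n-k))
        = (\<Sum>(k,i,j)\<in>(SIGMA k:{0..n}. {0..k} \<times> {0..n-k}). B (f$i) $ j * C (g$(k-i)) $ (n-k-j))"
      by (simp add: fps_mult_nth sum.Sigma sum.cartesian_product)
    also have "\<dots> = (\<Sum>(m,i,l)\<in>(SIGMA m:{0..n}. {0..m} \<times> {0..n-m}).
        B (f$i) $ (m-i) * C (g$l) $ (n-m-l))"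
      \<comment> \<open>Here \<open>i\<close> and \<open>l\<close> are the degrees taken from
        \<open>f\<close> and \<open>g\<close>, and \<open>j\<close> is the degree added by
        \<open>B\<close>. The outer index changes from \<open>i + l\<close> to the total degree
        \<open>i + j\<close> of the left factor.\<close>
      by (rule sum.reindex_bij_witness[where i = "\<lambda>(m,i,l). (i+l,i,m-i)" and j = "\<lambda>(k,i,j). (i+j,i,k-i)"])
        (auto simp: add.commute)
    also have "\<dots> = (fps_extend B f * fps_extend C g) $ n"
      by (simp add: fps_mult_nth fps_extend_def sum_product sum.Sigma sum.cartesian_product)
    finally show ?thesis .
  qed
  show "fps_extend A (f * g) $ n
      = (fps_extend B f * fps_extend C g + fps_extend B' f * fps_extend C' g) $ n"
    by (simp add: fps_extend_def[of A] fps_mult_nth[of f g] additive_sum(3)[of A, OF add]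
        fps_sum_nth mult sum.distrib rearrange)
qed

text \<open>This permits the final substitution of a series for \<open>v\<close> in an operator that
  is known on single polynomials.\<close>

lemma fps_extend_fps_extend:
  assumes add: "\<And>p q. A (p + q) = A p + A q"
  shows "fps_extend (\<lambda>p. fps_extend A (B p)) f = fps_extend A (fps_extend B f)"
proof (rule fps_ext)
  fix n
  have "fps_extend (\<lambda>p. fps_extend A (B p)) f $ n
      = (\<Sum>(k,j)\<in>(SIGMA k:{0..n}. {0..n-k}). A (B (f$k) $ j) $ (n-k-j))"
    by (simp add: fps_extend_def sum.Sigma)
  also have "\<dots> = (\<Sum>(m,k)\<in>(SIGMA m:{0..n}. {0..m}). A (B (f$k) $ (m-k)) $ (n-m))"
    by (rule sum.reindex_bij_witness[where i = "\<lambda>(m,k). (k,m-k)" and j = "\<lambda>(k,j). (k+j,k)"]) auto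
  also have "\<dots> = fps_extend A (fps_extend B f) $ n"
    by (simp add: fps_extend_def sum.Sigma additive_sum(3)[of A, OF add] fps_sum_nth)
  finally show "fps_extend (\<lambda>p. fps_extend A (B p)) f $ n = fps_extend A (fps_extend B f) $ n" .
qed

lemma fps_extend_mult_right: "fps_extend (\<lambda>p. B p * v) f = fps_extend B f * v"
proof (rule fps_ext)
  fix n
  have "fps_extend (\<lambda>p. B p * v) f $ n
      = (\<Sum>(k,j)\<in>(SIGMA k:{0..n}. {0..n-k}). B (f$k) $ j * v $ (n-k-j))"
    by (simp add: fps_extend_def fps_mult_nth sum.Sigma)
  also have "\<dots> = (\<Sum>(m,k)\<in>(SIGMA m:{0..n}. {0..m}). B (f$k) $ (m-k) * v $ (n-m))"
    by (rule sum.reindex_bij_witness[where i = "\<lambda>(m,k). (k,m-k)" and j = "\<lambda>(k,j). (k+j,k)"]) auto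
  also have "\<dots> = (fps_extend B f * v) $ n"
    by (simp add: fps_extend_def fps_mult_nth sum.Sigma sum_distrib_right)
  finally show "fps_extend (\<lambda>p. B p * v) f $ n = (fps_extend B f * v) $ n" .
qed

lemma fps_extend_mult_const_left: "fps_extend (\<lambda>p. fps_const u * B p) f = fps_const u * fps_extend B f"
  by (simp add: fps_extend_def fps_eq_iff sum_distrib_left)

section \<open>Generating series of inner harmonic products\<close>

text \<open>The sum of \<open>V ks\<close> over the compositions \<open>ks\<close> of \<open>n\<close>, each weighted by the product of \<open>a k\<close>
  over its parts.\<close>

fun comp_sum :: "(nat \<Rightarrow> rat) \<Rightarrow> nat \<Rightarrow> (nat list \<Rightarrow> ncpoly) \<Rightarrow> ncpoly" where
  "comp_sum a 0 V = V []"
| "comp_sum a (Suc n) V =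
     (\<Sum>k=0..n. const (a (Suc k)) * comp_sum a (n - k) (\<lambda>ks. V (Suc k # ks)))"

lemma comp_sum_add:
  "comp_sum a n (\<lambda>ks. V ks + W ks) = comp_sum a n V + comp_sum a n W"
  by (induction a n V arbitrary: W rule: comp_sum.induct) (simp_all add: distrib_left sum.distrib)

lemma comp_sum_cong:
  assumes "\<And>ks. \<forall>k\<in>set ks. 1 \<le> k \<Longrightarrow> V ks = W ks"
  shows "comp_sum a n V = comp_sum a n W"
  using assms
proof (induction a n V arbitrary: W rule: comp_sum.induct)
  case (2 a n V)
  have "comp_sum a (n - k) (\<lambda>ks. V (Suc k # ks)) = comp_sum a (n - k) (\<lambda>ks. W (Suc k # ks))"
    if "k \<in> {0..n}" for k
    using that by (intro "2.IH" "2.prems") auto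
  then show ?case by simp
qed simp

lemma comp_sum_linear:
  assumes "\<And>p q. L (p + q) = L p + L q" "\<And>c p. L (const c * p) = const c * L p"
  shows "L (comp_sum a n V) = comp_sum a n (\<lambda>ks. L (V ks))"
  by (induction a n V rule: comp_sum.induct) (simp_all add: additive_sum(3)[of L, OF assms(1)] assms(2))

lemma comp_sum_mult_left: "comp_sum a n (\<lambda>ks. p * V ks) = p * comp_sum a n V"
  by (rule comp_sum_linear[symmetric]) (simp_all add: distrib_left mult_const_left_commute)

text \<open>Splitting off the first part determines such a family. It serves for
  \<open>ones_star\<close>, with all weights 1, and for \<open>(- hy) ^ n\<close>, with weight -1 on
  the part 1 and 0 elsewhere.\<close>

lemma comp_sum_unique:
  assumes "P 0 = 1" "\<And>n. P (Suc n) = (\<Sum>k=0..n. const (a (Suc k)) * (mon (z_word [Suc k]) * P (n - k)))"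
  shows "P n = comp_sum a n (\<lambda>ks. mon (z_word ks))"
proof (induction n rule: less_induct)
  case (less n)
  show ?case
  proof (cases n)
    case 0
    then show ?thesis using assms(1) by (simp add: z_word_def mon_Nil)
  next
    case (Suc m)
    have "const (a (Suc k)) * (mon (z_word [Suc k]) * P (m - k)) =
        const (a (Suc k)) * comp_sum a (m - k) (\<lambda>ks. mon (z_word (Suc k # ks)))" for k
    proof -
      have "(\<lambda>ks. mon (z_word (Suc k # ks))) = (\<lambda>ks. mon (z_word [Suc k]) * mon (z_word ks))"
        by (rule ext) (rule mon_z_word_Cons)
      then show ?thesis using less[of "m - k"] Suc by (simp only: comp_sum_mult_left)
    qed
    then show ?thesis by (simp add: Suc assms(2))
  qed
qed

text \<open>In a product of \<open>\<Sum> t\<^sup>n comp_sum a n\<close> with \<open>z\<^sub>l\<^sub>1 \<dots> z\<^sub>l\<^sub>s\<close>, each \<open>z\<^sub>l\<close> gets multiplied on the right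
  by the first factor below, and the gaps are filled with powers of the second one.\<close>

definition merge_factor :: "(nat \<Rightarrow> rat) \<Rightarrow> ncpoly fps" where
  "merge_factor a = Abs_fps (\<lambda>n. if n = 0 then 1 else const (a n) * hx ^ n)"

definition insert_factor :: "(nat \<Rightarrow> rat) \<Rightarrow> ncpoly fps" where
  "insert_factor a = Abs_fps (\<lambda>n. if n = 0 then 0 else const (a n) * (hy * hx ^ (n - 1)))"

definition tail_series :: "(nat \<Rightarrow> rat) \<Rightarrow> nat list \<Rightarrow> ncpoly fps" where
  "tail_series a ls = Abs_fps (\<lambda>n. comp_sum a n (\<lambda>ks. tail_stuffle ks ls))"

lemma mon_replicate: "mon (replicate n LX) = hx ^ n"
proof (induction n)
  case (Suc n)
  then show ?case using mon_append[of "[LX]" "replicate n LX"] by (simp add: hx_def)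
qed (simp add: mon_Nil)

lemma mon_z_word_single: "mon (z_word [Suc k]) = hy * hx ^ k"
  using mon_append[of "[LY]" "replicate k LX"] by (simp add: z_word_def hy_def mon_replicate)

text \<open>Merging becomes right multiplication by a power of \<open>x\<close>, which is the source
  of \<open>merge_factor\<close>.\<close>

lemma mon_z_word_plus: "1 \<le> l \<Longrightarrow> mon (z_word [k + l]) = mon (z_word [l]) * hx ^ k"
  using mon_z_word_single[of "k + (l - 1)"] mon_z_word_single[of "l - 1"]
  by (simp add: mult.assoc add.commute flip: power_add)

text \<open>Only the empty composition contributes, since \<open>tail_stuffle\<close> vanishes on
  leftover parts.\<close>

lemma tail_series_Nil: "tail_series a [] = 1"
proof (rule fps_ext)
  fix n show "tail_series a [] $ n = 1 $ n"
    using comp_sum_mult_left[of a _ 0]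
    by (cases n) (simp_all add: tail_series_def z_word_def mon_Nil)
qed

text \<open>A part placed before \<open>l\<close> gives the last summand. Otherwise \<open>l\<close>
  comes first, alone (the constant coefficient 1 of \<open>merge_factor\<close>) or merged with a
  part.\<close>

lemma tail_series_Cons:
  assumes "1 \<le> l"
  shows "tail_series a (l # ls) = fps_const (mon (z_word [l])) * merge_factor a * tail_series a ls
      + insert_factor a * tail_series a (l # ls)" (is "?L = ?R")
proof (rule fps_ext)
  fix n
  show "?L $ n = ?R $ n"
  proof (cases n)
    case 0
    then show ?thesis
      by (simp add: tail_series_def merge_factor_def insert_factor_def mon_z_word_Cons[of l ls])
  next
    case (Suc m)
    let ?T = "tail_series a ls" and ?z = "mon (z_word [l])"
    have T: "?T $ Suc m = (\<Sum>k=0..m. const (a (Suc k)) * comp_sum a (m - k) (\<lambda>ks. tail_stuffle (Suc k # ks) ls))"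
      by (simp add: tail_series_def)
    have "?L $ Suc m = (\<Sum>k=0..m. const (a (Suc k)) *
        (hy * hx ^ k * ?L $ (m - k) + ?z * comp_sum a (m - k) (\<lambda>ks. tail_stuffle (Suc k # ks) ls)
          + ?z * hx ^ Suc k * ?T $ (m - k)))"
      using mon_z_word_plus[OF assms, of "Suc _"]
      by (simp add: tail_series_def comp_sum_add comp_sum_mult_left mon_z_word_single del: power_Suc)
    also have "\<dots> = ?z * (?T $ Suc m + (\<Sum>k=0..m. const (a (Suc k)) * hx ^ Suc k * ?T $ (m - k)))
        + (\<Sum>k=0..m. const (a (Suc k)) * (hy * hx ^ k) * ?L $ (m - k))"
      unfolding T
      by (simp add: distrib_left sum.distrib sum_distrib_left mult.assoc mult_const_left_commute add_ac
        del: power_Suc)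
    also have "\<dots> = ?R $ Suc m"
      by (simp add: mult.assoc fps_mult_nth sum.atLeast0_atMost_Suc_shift merge_factor_def
         insert_factor_def del: power_Suc sum.cl_ivl_Suc)
    finally show ?thesis using Suc by simp
  qed
qed

lemma inner_harmonic_linear_right:
  "inner_harmonic p (q + q') = inner_harmonic p q + inner_harmonic p q'"
  "inner_harmonic p (const c * q) = const c * inner_harmonic p q"
  by (simp_all add: inner_harmonic_def bilinext_bilinear)

lemma inner_harmonic_linear_left:
  "inner_harmonic (p + p') q = inner_harmonic p q + inner_harmonic p' q"
  "inner_harmonic (const c * p) q = const c * inner_harmonic p q"
  by (simp_all add: inner_harmonic_def bilinext_bilinear)

text \<open>As in \<open>tail_series_Cons\<close>, but no part may precede the leading
  \<open>l\<close>, so the insertion term is absent.\<close>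

lemma inner_harmonic_series_word:
  assumes "\<forall>k\<in>set (l # ls). 1 \<le> k"
  shows "Abs_fps (\<lambda>n. inner_harmonic (comp_sum a n (\<lambda>ks. mon (z_word ks))) (mon (z_word (l # ls)))) =
    fps_const (mon (z_word [l])) * merge_factor a * tail_series a ls" (is "?L = ?R")
proof (rule fps_ext)
  fix n
  let ?T = "tail_series a ls" and ?z = "mon (z_word [l])"
  have "?L $ n = comp_sum a n (\<lambda>ks. inner_harmonic_word (z_word ks) (z_word (l # ls)))"
    by (simp add: comp_sum_linear[of "\<lambda>p. inner_harmonic p (mon (z_word (l # ls)))"]
      inner_harmonic_linear_left) (simp add: inner_harmonic_def bilinext_mon)
  also have "\<dots> = comp_sum a n (\<lambda>ks. ?z * tail_stuffle ks ls +
      (case ks of [] \<Rightarrow> 0 | k # ks' \<Rightarrow> mon (z_word [k + l]) * tail_stuffle ks' ls))"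
    using assms by (intro comp_sum_cong inner_harmonic_word_z_word)
  also have "\<dots> = ?R $ n"
  proof (cases n)
    case 0
    then show ?thesis by (simp add: tail_series_def merge_factor_def)
  next
    case (Suc m)
    have T: "?T $ Suc m = (\<Sum>k=0..m. const (a (Suc k)) * comp_sum a (m - k) (\<lambda>ks. tail_stuffle (Suc k # ks) ls))"
      by (simp add: tail_series_def)
    have "comp_sum a n (\<lambda>ks. ?z * tail_stuffle ks ls +
      (case ks of [] \<Rightarrow> 0 | k # ks' \<Rightarrow> mon (z_word [k + l]) * tail_stuffle ks' ls))
      = (\<Sum>k=0..m. const (a (Suc k)) * (?z * comp_sum a (m - k) (\<lambda>ks. tail_stuffle (Suc k # ks) ls)
          + ?z * hx ^ Suc k * ?T $ (m - k)))"
      using mon_z_word_plus[of l "Suc _"] assms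
      by (simp add: Suc tail_series_def comp_sum_add comp_sum_mult_left distrib_left sum.distrib
          sum_distrib_left mult_const_left_commute del: power_Suc)
    also have "\<dots> = ?z * (?T $ Suc m + (\<Sum>k=0..m. const (a (Suc k)) * hx ^ Suc k * ?T $ (m - k)))"
      unfolding T
      by (simp add: distrib_left sum.distrib sum_distrib_left mult.assoc mult_const_left_commute
        del: power_Suc)
    also have "\<dots> = ?R $ Suc m"
      by (simp add: mult.assoc fps_mult_nth sum.atLeast0_atMost_Suc_shift merge_factor_def
         insert_factor_def del: power_Suc sum.cl_ivl_Suc)
    finally show ?thesis using Suc by simp
  qed
  finally show "?L $ n = ?R $ n" .
qed

section \<open>Weighted products as algebra homomorphisms\<close>

definition letter_map :: "ncpoly fps \<Rightarrow> letter \<Rightarrow> ncpoly fps" where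
  "letter_map b u = (case u of LX \<Rightarrow> fps_const hx | LY \<Rightarrow> b * fps_const hy)"

lemma letter_map_simps [simp]:
  "letter_map b LX = fps_const hx" "letter_map b LY = b * fps_const hy"
  by (simp_all add: letter_map_def)

lemma word_decomposition:
  obtains m ls where "u = replicate m LX @ z_word ls" "\<forall>k\<in>set ls. 1 \<le> k"
proof -
  have "\<exists>m ls. u = replicate m LX @ z_word ls \<and> (\<forall>k\<in>set ls. 1 \<le> k)"
  proof (induction u)
    case Nil
    then show ?case by (auto simp: z_word_def intro!: exI[of _ "[]"])
  next
    case (Cons a u)
    then obtain m ls where u: "u = replicate m LX @ z_word ls" "\<forall>k\<in>set ls. 1 \<le> k" by blast
    show ?case
    proof (cases a)
      case LX
      then show ?thesis using u by (intro exI[of _ "Suc m"] exI[of _ ls]) simp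
    next
      case LY
      then show ?thesis using u
        by (intro exI[of _ 0] exI[of _ "Suc m # ls"]) (simp add: z_word_def)
    qed
  qed
  then show ?thesis using that by blast
qed

lemma fps_hom_hx_power: "fps_hom (letter_map b) (hx ^ m) = fps_const hx ^ m"
  by (induction m) (simp_all add: fps_hom_1 fps_hom_mult fps_hom_letters)

text \<open>Write \<open>M\<close> for the merge factor and \<open>T\<close> for the tail series.
  Solving \<open>tail_series_Cons\<close> gives \<open>M T(l # ls) = M L z_l (M T(ls))\<close>, so
  every \<open>y\<close> acquires the factor \<open>M L\<close> on its left, and one
  \<open>M\<close> is left over at the right end.\<close>

lemma merge_factor_tail_series:
  assumes "L * (1 - insert_factor a) = 1" "\<forall>k\<in>set ls. 1 \<le> k"
  shows "merge_factor a * tail_series a ls =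
    fps_hom (letter_map (merge_factor a * L)) (mon (z_word ls)) * merge_factor a"
  using assms(2)
proof (induction ls)
  case Nil
  then show ?case by (simp add: tail_series_Nil z_word_def mon_Nil fps_hom_1)
next
  case (Cons l ls)
  let ?M = "merge_factor a" and ?T = "tail_series a" and ?h = "fps_hom (letter_map (merge_factor a * L))"
  have l: "l = Suc (l - 1)" using Cons.prems by simp
  have z: "mon (z_word [l]) = hy * hx ^ (l - 1)" by (subst l) (rule mon_z_word_single)
  have "(1 - insert_factor a) * ?T (l # ls) = fps_const (mon (z_word [l])) * ?M * ?T ls"
    using tail_series_Cons[of l a ls] Cons.prems by (simp add: left_diff_distrib algebra_simps)
  then have "L * ((1 - insert_factor a) * ?T (l # ls)) = L * (fps_const (mon (z_word [l])) * ?M * ?T ls)"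
    by (rule arg_cong)
  then have "?T (l # ls) = L * fps_const (mon (z_word [l])) * (?M * ?T ls)"
    by (simp add: assms(1) flip: mult.assoc)
  also have "\<dots> = L * fps_const (mon (z_word [l])) * (?h (mon (z_word ls)) * ?M)"
    using Cons by simp
  finally show ?case
    by (simp add: mon_z_word_Cons[of l ls] z fps_hom_mult fps_hom_hx_power fps_hom_letters
      mult.assoc fps_const_power flip: fps_const_mult)
qed

text \<open>Nothing is inserted before the leading \<open>y\<close>, so it stays outside the
  homomorphism. The letters \<open>x\<close> at the front of a word of \<open>p\<close> join it to
  form the first \<open>z\<close>.\<close>

lemma inner_harmonic_series:
  assumes "L * (1 - insert_factor a) = 1" "P 0 = 1"
    "\<And>n. P (Suc n) = (\<Sum>k=0..n. const (a (Suc k)) * (mon (z_word [Suc k]) * P (n - k)))"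
  shows "Abs_fps (\<lambda>n. inner_harmonic (P n) (hy * p)) =
    fps_const hy * (fps_hom (letter_map (merge_factor a * L)) p * merge_factor a)"
proof (induction p rule: ncpoly_induct)
  case zero
  show ?case using inner_harmonic_linear_right(2)[of _ 0 0]
    by (simp add: const_0 fps_hom_linear fps_eq_iff)
next
  case (mon c u)
  obtain m ls where u: "u = replicate m LX @ z_word ls" "\<forall>k\<in>set ls. 1 \<le> k"
    by (rule word_decomposition)
  have y: "hy * mon u = mon (z_word (Suc m # ls))"
    by (simp add: u(1) hy_def z_word_def flip: mon_append)
  have P: "P n = comp_sum a n (\<lambda>ks. mon (z_word ks))" for n
    using assms(2,3) by (rule comp_sum_unique)
  have "Abs_fps (\<lambda>n. inner_harmonic (P n) (hy * mon u)) =
      fps_const (mon (z_word [Suc m])) * (merge_factor a * tail_series a ls)"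
    unfolding P y using u(2) by (subst inner_harmonic_series_word) (simp_all add: mult.assoc)
  also have "\<dots> = fps_const hy * (fps_hom (letter_map (merge_factor a * L)) (mon u) * merge_factor a)"
    by (simp add: merge_factor_tail_series[OF assms(1) u(2)] u(1) mon_append mon_replicate mon_z_word_single
       fps_hom_mult fps_hom_hx_power mult.assoc fps_const_power flip: fps_const_mult)
  finally show ?case
    by (simp add: mult_const_left_commute inner_harmonic_linear_right fps_hom_linear fps_eq_iff mult.assoc)
next
  case (add p q)
  then show ?case by (simp add: distrib_left distrib_right inner_harmonic_linear_right fps_hom_linear fps_eq_iff)
qed

section \<open>The operators as series\<close>

definition geometric :: "ncpoly \<Rightarrow> ncpoly fps" where
  "geometric p = Abs_fps (\<lambda>n. p ^ n)"

lemma fps_X_left_commute: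
  fixes f g :: "'a::semiring_1 fps"
  shows "f * (fps_X * g) = fps_X * (f * g)"
  by (simp only: mult.assoc[symmetric] fps_mult_fps_X_commute[of f])

lemma geometric_unfold:
  "geometric p = 1 + fps_X * (fps_const p * geometric p)"
  "geometric p = 1 + fps_X * (geometric p * fps_const p)"
proof -
  have "geometric p $ n = (1 + fps_X * (fps_const p * geometric p)) $ n" for n
    by (cases n) (simp_all add: geometric_def)
  then show "geometric p = 1 + fps_X * (fps_const p * geometric p)" by (rule fps_ext)
  have "geometric p $ n = (1 + fps_X * (geometric p * fps_const p)) $ n" for n
    by (cases n) (simp_all add: geometric_def power_commutes)
  then show "geometric p = 1 + fps_X * (geometric p * fps_const p)" by (rule fps_ext)
qed

lemma geometric_inverse:
  "(1 - fps_X * fps_const p) * geometric p = 1" "geometric p * (1 - fps_X * fps_const p) = 1"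
  by (simp_all add: left_diff_distrib right_diff_distrib mult.assoc fps_X_left_commute diff_eq_eq
      flip: geometric_unfold)

lemma geometric_commute: "geometric p * fps_const p = fps_const p * geometric p"
  by (simp add: geometric_def fps_eq_iff power_commutes)

lemma geometric_solve:
  assumes "f = g + fps_X * (fps_const p * f)"
  shows "f = geometric p * g"
proof -
  have "(1 - fps_X * fps_const p) * f = g"
    using assms by (simp add: left_diff_distrib mult.assoc diff_eq_eq)
  then have "geometric p * ((1 - fps_X * fps_const p) * f) = geometric p * g" by simp
  then show ?thesis by (simp add: geometric_inverse(2) flip: mult.assoc)
qed

abbreviation "cx \<equiv> fps_const hx"
abbreviation "cy \<equiv> fps_const hy"
abbreviation "Gx \<equiv> geometric hx"
abbreviation "Gz \<equiv> geometric (hx + hy)"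

lemma fps_const_hx_hy: "fps_const (hx + hy) = cx + cy"
  by simp

section \<open>Products with \<open>{1}\<^sub>\<star>\<^sup>n\<close> and with powers of
  \<open>- y\<close>\<close>

lemma merge_factor_ones: "merge_factor (\<lambda>_. 1) = Gx"
  by (simp add: merge_factor_def geometric_def const_one fps_eq_iff)

lemma insert_factor_ones: "insert_factor (\<lambda>_. 1) = fps_X * (cy * Gx)"
proof (rule fps_ext)
  fix n show "insert_factor (\<lambda>_. 1) $ n = (fps_X * (cy * Gx)) $ n"
    by (cases n) (simp_all add: insert_factor_def geometric_def const_one)
qed

text \<open>Since \<open>1 - t x - t y = 1 - t z\<close>, one has
  \<open>1 - t y G = (1 - t z) G\<close>.\<close>

lemma insert_factor_ones_inverse:
  "((1 - fps_X * cx) * Gz) * (1 - insert_factor (\<lambda>_. 1)) = 1"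
proof -
  have "(1 - fps_X * fps_const (hx + hy)) * Gx = (1 - fps_X * cx) * Gx - fps_X * (cy * Gx)"
    by (simp add: algebra_simps flip: fps_const_add)
  then have "1 - fps_X * (cy * Gx) = (1 - fps_X * fps_const (hx + hy)) * Gx"
    by (simp only: geometric_inverse)
  then have "(1 - fps_X * cx) * Gz * (1 - fps_X * (cy * Gx)) =
      (1 - fps_X * cx) * (Gz * (1 - fps_X * fps_const (hx + hy))) * Gx"
    by (simp only: mult.assoc)
  then show ?thesis by (simp only: insert_factor_ones geometric_inverse mult_1_right)
qed

lemma ones_star_series: "Abs_fps ones_star = (1 - fps_X * cx) * Gz"
proof -
  have "Abs_fps ones_star $ n = (1 + fps_X * (cy * Gz)) $ n" for n
    by (cases n) (simp_all add: ones_star_def geometric_def)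
  then have "Abs_fps ones_star = 1 + fps_X * (cy * Gz)" by (rule fps_ext)
  also have "\<dots> = (1 - fps_X * fps_const (hx + hy)) * Gz + fps_X * (cy * Gz)"
    by (simp only: geometric_inverse)
  also have "\<dots> = (1 - fps_X * cx) * Gz"
    by (simp add: algebra_simps flip: fps_const_add)
  finally show ?thesis .
qed

text \<open>Multiplying the series of \<open>ones_star\<close> by G gives R; this is compared in
  degree \<open>n\<close> after multiplication by \<open>y\<close>.\<close>

lemma ones_star_Suc:
  "ones_star (Suc n) = (\<Sum>k=0..n. const 1 * (mon (z_word [Suc k]) * ones_star (n - k)))"
proof -
  have "cy * (Gx * Abs_fps ones_star) = cy * Gz"
    by (simp add: ones_star_series geometric_inverse flip: mult.assoc)
  then have "hy * (Gx * Abs_fps ones_star) $ n = hy * Gz $ n"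
    by (metis fps_mult_left_const_nth)
  then show ?thesis
    by (simp add: fps_mult_nth geometric_def ones_star_def[of "Suc n"] const_one mon_z_word_single
        sum_distrib_left mult.assoc)
qed

definition star_hom :: "ncpoly \<Rightarrow> ncpoly fps" where
  "star_hom = fps_hom (letter_map Gz)"

lemma ones_star_harmonic_series:
  "Abs_fps (\<lambda>n. inner_harmonic (ones_star n) (hy * p)) = cy * (star_hom p * Gx)"
proof -
  \<comment> \<open>The factor on \<open>y\<close>, namely \<open>merge_factor\<close> times the
    inverse of one minus the insertion series, collapses to R.\<close>
  have "Gx * ((1 - fps_X * cx) * Gz) = Gz"
    by (simp add: geometric_inverse flip: mult.assoc)
  then show ?thesis
    using inner_harmonic_series[OF insert_factor_ones_inverse, of ones_star p] ones_star_Suc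
    by (simp add: merge_factor_ones star_hom_def ones_star_def[of 0])
qed

definition ones_hom :: "ncpoly \<Rightarrow> ncpoly fps" where
  "ones_hom = fps_hom (letter_map ((1 - fps_X * cx) * geometric (- hy)))"

lemma const_minus_one: "const (- 1) = - 1"
  by (metis add.right_inverse add_eq_0_iff const_0 const_add const_one)

lemma ones_harmonic_series:
  "Abs_fps (\<lambda>n. inner_harmonic ((- hy) ^ n) (hy * p)) = cy * (ones_hom p * (1 - fps_X * cx))"
proof -
  \<comment> \<open>Only the composition with all parts equal to 1 survives, giving
    \<open>(- y)^n\<close>. The merge factor becomes \<open>1 - t x\<close> and the insertion factor
    \<open>- t y\<close>.\<close>
  let ?a = "\<lambda>k::nat. if k = Suc 0 then - 1 else 0 :: rat"
  have M: "merge_factor ?a = 1 - fps_X * cx"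
    by (rule fps_ext) (auto simp: merge_factor_def const_minus_one const_0)
  have "insert_factor ?a $ n = (fps_X * fps_const (- hy)) $ n" for n
    by (cases n) (auto simp: insert_factor_def const_minus_one const_0)
  then have I: "insert_factor ?a = fps_X * fps_const (- hy)" by (rule fps_ext)
  have P: "(- hy) ^ Suc n =
      (\<Sum>k=0..n. const (?a (Suc k)) * (mon (z_word [Suc k]) * (- hy) ^ (n - k)))" for n
  proof -
    have "(\<Sum>k=0..n. const (?a (Suc k)) * (mon (z_word [Suc k]) * (- hy) ^ (n - k))) =
        (\<Sum>k=0..n. if k = 0 then (- hy) ^ Suc n else 0)"
      by (rule sum.cong) (simp_all add: const_minus_one const_0 mon_z_word_single)
    then show ?thesis by simp
  qed
  show ?thesis
    using inner_harmonic_series[of "geometric (- hy)" ?a "\<lambda>n. (- hy) ^ n" p, OF _ _ P]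
      geometric_inverse(2)[of "- hy"]
    by (simp add: M I ones_hom_def)
qed

section \<open>The homomorphism \<sigma> inverts \<phi>\<close>

lemma star_hom_linear:
  "star_hom 0 = 0" "star_hom (p + q) = star_hom p + star_hom q"
  "star_hom (const c * p) = fps_const (const c) * star_hom p"
  by (simp_all add: star_hom_def fps_hom_linear)

lemma star_hom_mult: "star_hom (p * q) = star_hom p * star_hom q"
  by (simp add: star_hom_def fps_hom_mult)

lemma star_hom_letters: "star_hom hx = cx" "star_hom hy = Gz * cy"
  by (simp_all add: star_hom_def fps_hom_letters)

lemma star_hom_1: "star_hom 1 = 1"
  by (simp add: star_hom_def fps_hom_1)

lemma fps_extend_star_hom_mult:
  "fps_extend star_hom (f * g) = fps_extend star_hom f * fps_extend star_hom g"
proof -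
  have "fps_extend (\<lambda>_. 0) h = 0" for h by (simp add: fps_extend_def fps_eq_iff)
  then show ?thesis
    using fps_extend_mult[of star_hom star_hom star_hom "\<lambda>_. 0" "\<lambda>_. 0" f g]
    by (simp add: star_hom_linear star_hom_mult)
qed

lemma fps_extend_star_hom:
  "fps_extend star_hom (f + g) = fps_extend star_hom f + fps_extend star_hom g"
  "fps_extend star_hom (- f) = - fps_extend star_hom f"
  "fps_extend star_hom (fps_const p) = star_hom p"
  "fps_extend star_hom (fps_X * f) = fps_X * fps_extend star_hom f"
  by (simp_all add: fps_extend_add fps_extend_minus fps_extend_const fps_extend_fps_X star_hom_linear)

lemma fps_extend_star_hom_1: "fps_extend star_hom 1 = 1"
  using fps_extend_star_hom(3)[of 1] by (simp add: star_hom_1)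

lemma fps_extend_star_hom_one_minus_X:
  "fps_extend star_hom (1 - fps_X * cx) = 1 - fps_X * cx"
  using fps_extend_star_hom(1)[of 1 "- (fps_X * cx)"]
  by (simp add: fps_extend_star_hom fps_extend_star_hom_1 star_hom_letters)

text \<open>\<sigma> maps \<open>1 + t y\<close> to \<open>1 + t R y = R (1 - t x)\<close>. Hence
  \<phi>(y) is sent to \<open>(1 - t x) (G R^-1) (R y) = y\<close>.\<close>

lemma star_hom_ones_hom_hy: "fps_extend star_hom (ones_hom hy) = cy"
proof -
  let ?H = "fps_extend star_hom (geometric (- hy))"
  have "fps_extend star_hom (geometric (- hy) * (1 + fps_X * cy)) = 1"
    using geometric_inverse(2)[of "- hy"] by (simp add: fps_extend_star_hom_1 flip: fps_const_neg)
  then have "?H * (1 + fps_X * (Gz * cy)) = 1"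
    by (simp add: fps_extend_star_hom_mult[of "geometric _"] fps_extend_star_hom
        fps_extend_star_hom_1 star_hom_letters)
  moreover have "Gz * (1 - fps_X * fps_const (hx + hy)) + fps_X * (Gz * cy) = Gz * (1 - fps_X * cx)"
    by (simp add: algebra_simps fps_X_left_commute flip: fps_const_add)
  then have "1 + fps_X * (Gz * cy) = Gz * (1 - fps_X * cx)"
    by (simp only: geometric_inverse)
  ultimately have "?H * Gz * (1 - fps_X * cx) * Gx = Gx" by (simp add: mult.assoc)
  then have "?H * Gz = Gx" by (simp add: mult.assoc geometric_inverse)
  then have "(1 - fps_X * cx) * (?H * Gz) * cy = cy" by (simp add: geometric_inverse)
  then show ?thesis
    by (simp add: ones_hom_def fps_hom_letters fps_extend_star_hom_mult fps_extend_star_hom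
        fps_extend_star_hom_one_minus_X star_hom_letters mult.assoc)
qed

lemma star_hom_ones_hom: "fps_extend star_hom (ones_hom p) = fps_const p"
proof (induction p rule: ncpoly_induct)
  case zero
  show ?case using fps_extend_star_hom(3)[of 0] by (simp add: ones_hom_def fps_hom_linear star_hom_linear)
next
  case (mon c w)
  have "fps_extend star_hom (ones_hom (mon w)) = fps_const (mon w)"
  proof (induction w)
    case Nil
    show ?case by (simp add: mon_Nil ones_hom_def fps_hom_1 fps_extend_star_hom_1)
  next
    case (Cons a w)
    have "fps_extend star_hom (ones_hom (mon [a])) = fps_const (mon [a])"
    proof (cases a)
      case LX
      have "ones_hom hx = cx" by (simp add: ones_hom_def fps_hom_letters)
      with LX show ?thesis
        by (simp add: fps_extend_star_hom star_hom_letters flip: hx_def)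
    next
      case LY
      then show ?thesis using star_hom_ones_hom_hy by (simp flip: hy_def)
    qed
    then show ?case
      using Cons mon_append[of "[a]" w]
      by (simp add: ones_hom_def fps_hom_mult fps_extend_star_hom_mult)
  qed
  moreover have "star_hom (const c) = fps_const (const c)"
    using star_hom_linear(3)[of c 1] by (simp add: star_hom_1)
  ultimately show ?case
    by (simp add: ones_hom_def fps_hom_linear fps_extend_star_hom_mult fps_extend_star_hom)
next
  case (add p q)
  then show ?case by (simp add: ones_hom_def fps_hom_linear fps_extend_star_hom)
qed

section \<open>The derivations \<open>\<partial>\<^sub>m\<close> on power series\<close>

definition partial_series :: "ncpoly \<Rightarrow> ncpoly fps" where
  "partial_series p = Abs_fps (\<lambda>n. partial_deriv (Suc n) p)"

lemma partial_deriv_rules: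
  "partial_deriv m (p + q) = partial_deriv m p + partial_deriv m q"
  "partial_deriv m (const c * p) = const c * partial_deriv m p"
  "partial_deriv m (p * q) = partial_deriv m p * q + p * partial_deriv m q"
  using partial_deriv(1)[of m] by (auto simp: derivation_def)

lemma partial_series_rules:
  "partial_series (p + q) = partial_series p + partial_series q"
  "partial_series (p * q) = partial_series p * fps_const q + fps_const p * partial_series q"
  by (simp_all add: partial_series_def partial_deriv_rules fps_eq_iff)

lemma partial_series_letters:
  "partial_series hx = cy * (Gz * cx)" "partial_series hy = - (cy * (Gz * cx))"
  by (simp_all add: partial_series_def partial_deriv geometric_def fps_eq_iff mult.assoc)

definition partial_ext :: "ncpoly fps \<Rightarrow> ncpoly fps" where
  "partial_ext = fps_extend partial_series"

lemma partial_ext_rules: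
  "partial_ext (f + g) = partial_ext f + partial_ext g"
  "partial_ext (fps_X * f) = fps_X * partial_ext f"
  "partial_ext (fps_const p) = partial_series p"
  "partial_ext (f * g) = partial_ext f * g + f * partial_ext g"
proof -
  \<comment> \<open>The undifferentiated factor enters \<open>fps_extend_mult\<close> through the
    embedding \<open>fps_const\<close>, whose extension is the identity.\<close>
  have "fps_extend fps_const f = f" for f
  proof (rule fps_ext)
    fix n
    have "fps_extend fps_const f $ n = (\<Sum>k=0..n. if k = n then f $ n else 0)"
      unfolding fps_extend_def fps_nth_Abs_fps by (rule sum.cong) auto
    then show "fps_extend fps_const f $ n = f $ n" by simp
  qed
  then show "partial_ext (f * g) = partial_ext f * g + f * partial_ext g"
    using fps_extend_mult[of partial_series partial_series fps_const fps_const partial_series f g]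
    by (simp add: partial_ext_def partial_series_rules)
qed (simp_all add: partial_ext_def fps_extend_add fps_extend_const fps_extend_fps_X
    partial_series_rules)

lemma partial_ext_1: "partial_ext 1 = 0"
  using partial_ext_rules(4)[of 1 1] by simp

text \<open>The rule \<open>D(u^-1) = - u^-1 D(u) u^-1\<close> for \<open>u = 1 - t p\<close>,
  obtained from the fixed point equation of the geometric series.\<close>

lemma partial_ext_geometric:
  "partial_ext (geometric p) = fps_X * (geometric p * (partial_series p * geometric p))"
proof -
  have "partial_ext (geometric p) = partial_ext (1 + fps_X * (fps_const p * geometric p))"
    by (subst geometric_unfold(1)) simp
  also have "\<dots> = fps_X * (partial_series p * geometric p) + fps_X * (fps_const p * partial_ext (geometric p))"
    by (simp add: partial_ext_rules(1,2) partial_ext_rules(4)[of "fps_const p"] partial_ext_rules(3)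
        partial_ext_1 distrib_left)
  finally have "partial_ext (geometric p) = geometric p * (fps_X * (partial_series p * geometric p))"
    by (rule geometric_solve)
  then show ?thesis by (simp only: fps_X_left_commute)
qed

lemma fps_deriv_geometric: "fps_deriv (geometric p) = geometric p * (fps_const p * geometric p)"
proof (rule geometric_solve)
  have "fps_deriv (geometric p) = fps_deriv (1 + fps_X * (fps_const p * geometric p))"
    by (subst geometric_unfold(1)) simp
  then show "fps_deriv (geometric p) =
      fps_const p * geometric p + fps_X * (fps_const p * fps_deriv (geometric p))"
    by (simp add: add.commute)
qed

text \<open>The derivations take opposite values on \<open>x\<close> and \<open>y\<close>, so they
  kill \<open>z\<close>.\<close>

lemma partial_ext_Gz: "partial_ext Gz = 0"
  by (simp add: partial_ext_geometric partial_series_rules partial_series_letters)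

section \<open>The inner shuffle with \<open>y\<close> as a derivation\<close>

definition insert_y :: "ncpoly \<Rightarrow> ncpoly" where
  "insert_y = linext (leibniz_word (\<lambda>u. hy * mon [u]))"

lemma insert_y_rules:
  "insert_y (p + q) = insert_y p + insert_y q"
  "insert_y (const c * p) = const c * insert_y p"
  "insert_y (p * q) = insert_y p * q + p * insert_y q"
  using derivation_linext_leibniz[of "\<lambda>u. hy * mon [u]"] unfolding insert_y_def derivation_def by blast+

lemma insert_y_letters: "insert_y hx = hy * hx" "insert_y hy = hy * hy"
  by (simp_all add: insert_y_def hx_def linext_mon mon_Nil) (simp add: hy_def linext_mon mon_Nil)

text \<open>The letter \<open>y\<close> lands directly before a letter of \<open>v\<close>, which
  gives \<delta>(v), or at the end.\<close>

lemma shuffle_word_y: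
  "shuffle_word [LY] v = leibniz_word (\<lambda>u. hy * mon [u]) v + mon v * hy"
proof (induction v)
  case Nil
  show ?case by (simp add: hy_def mon_Nil)
next
  case (Cons a v)
  then show ?case
    using mon_append[of "[a]" v] by (simp add: hy_def distrib_left mult.assoc)
qed

lemma inner_shuffle_linear_right:
  "inner_shuffle p (q + q') = inner_shuffle p q + inner_shuffle p q'"
  "inner_shuffle p (const c * q) = const c * inner_shuffle p q"
  by (simp_all add: inner_shuffle_def bilinext_bilinear)

lemma inner_shuffle_hy: "inner_shuffle hy (hy * p) = hy * insert_y p"
proof (induction p rule: ncpoly_induct)
  case zero
  show ?case
    using inner_shuffle_linear_right(2)[of hy 0 0] insert_y_rules(2)[of 0 0] by (simp add: const_0)
next
  case (mon c u)
  have "inner_shuffle hy (hy * mon u) = inner_shuffle_word [LY] (LY # u)"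
    using mon_append[of "[LY]" u] by (simp add: inner_shuffle_def hy_def bilinext_mon flip: mon_append)
  also have "\<dots> = hy * insert_y (mon u)"
  proof (cases u rule: rev_cases)
    case Nil
    then show ?thesis by (simp add: inner_shuffle_word_def insert_y_def linext_mon)
  next
    \<comment> \<open>The shuffle takes place strictly inside the word. Its term with
      \<open>y\<close> after \<open>v\<close> is the insertion before the last letter:
      \<open>\<delta>(v) a + v y a = \<delta>(v a)\<close>.\<close>
    case (snoc v a)
    have "bilinext shuffle_word hy (mon v) = shuffle_word [LY] v"
      by (simp add: hy_def bilinext_mon)
    with snoc show ?thesis
      by (simp add: inner_shuffle_word_def shuffle_def shuffle_word_y insert_y_def
          linext_mon leibniz_word_append mon_Nil distrib_left distrib_right mult.assoc flip: hy_def)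
  qed
  finally show ?case
    by (simp add: mult_const_left_commute inner_shuffle_linear_right insert_y_rules(2))
next
  case (add p q)
  then show ?case by (simp add: distrib_left inner_shuffle_linear_right insert_y_rules)
qed

text \<open>The commutator with \<open>c = R x\<close> is a derivation as well, so all terms obey a
  Leibniz rule along \<sigma> and the letters suffice. The term \<open>c \<sigma>(p)\<close> stands
  on the left to avoid subtraction.\<close>

lemma star_hom_insert_y:
  "star_hom (insert_y p) + Gz * cx * star_hom p =
     fps_deriv (star_hom p) + partial_ext (star_hom p) + star_hom p * (Gz * cx)"
proof (induction p rule: ncpoly_induct)
  case zero
  show ?case using insert_y_rules(2)[of 0 0] partial_ext_rules(1)[of 0 0]
    by (simp add: const_0 star_hom_linear)
next
  case (mon c w)
  have "star_hom (insert_y (mon w)) + Gz * cx * star_hom (mon w) =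
     fps_deriv (star_hom (mon w)) + partial_ext (star_hom (mon w)) + star_hom (mon w) * (Gz * cx)"
  proof (induction w)
    case Nil
    have "insert_y 1 = 0" using insert_y_rules(3)[of 1 1] by simp
    then show ?case by (simp add: mon_Nil star_hom_1 star_hom_linear partial_ext_1)
  next
    case (Cons a w)
    let ?p = "mon [a]" and ?q = "mon w"
    have letter: "star_hom (insert_y ?p) + Gz * cx * star_hom ?p =
       fps_deriv (star_hom ?p) + partial_ext (star_hom ?p) + star_hom ?p * (Gz * cx)"
    proof (cases a)
      case LX
      \<comment> \<open>For \<open>x\<close> the claim amounts to
        \<open>R z x = z R x\<close>.\<close>
      have "Gz * fps_const (hx + hy) * cx = fps_const (hx + hy) * Gz * cx"
        by (simp only: geometric_commute)
      then have "Gz * (cy * cx) + Gz * (cx * cx) = cy * (Gz * cx) + cx * (Gz * cx)"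
        by (simp add: algebra_simps flip: fps_const_add del: fps_const_mult)
      with LX show ?thesis
        by (simp add: insert_y_letters star_hom_mult star_hom_letters partial_ext_rules(3)
            partial_series_letters mult.assoc flip: hx_def)
    next
      case LY
      \<comment> \<open>For \<open>y\<close> the t-derivative of R gives \<open>R z R y\<close>,
        while the contribution of \<Delta>(y), \<open>- R y c\<close>, cancels against
        \<open>\<sigma>(y) c\<close>.\<close>
      show ?thesis unfolding LY hy_def[symmetric]
        by (simp add: insert_y_letters star_hom_mult star_hom_letters
            partial_ext_rules(4)[of Gz] partial_ext_rules(3) partial_ext_Gz
            partial_series_letters fps_deriv_geometric algebra_simps flip: fps_const_add)
    qed
    have "star_hom (insert_y (?p * ?q)) + Gz * cx * star_hom (?p * ?q) =
        (star_hom (insert_y ?p) + Gz * cx * star_hom ?p) * star_hom ?q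
        + star_hom ?p * star_hom (insert_y ?q)"
      by (simp add: insert_y_rules star_hom_linear star_hom_mult algebra_simps)
    \<comment> \<open>The term \<open>c\<close> moves from the right of the first factor to the left
      of the second, where the induction hypothesis needs it.\<close>
    also have "\<dots> = (fps_deriv (star_hom ?p) + partial_ext (star_hom ?p)) * star_hom ?q
        + star_hom ?p * (star_hom (insert_y ?q) + Gz * cx * star_hom ?q)"
      unfolding letter by (simp add: algebra_simps)
    also have "\<dots> = fps_deriv (star_hom (?p * ?q)) + partial_ext (star_hom (?p * ?q))
        + star_hom (?p * ?q) * (Gz * cx)"
      unfolding Cons by (simp add: star_hom_mult partial_ext_rules(4) algebra_simps)
    finally show ?case using mon_append[of "[a]" w] by simp
  qed
  then have "fps_const (const c) * (star_hom (insert_y (mon w)) + Gz * cx * star_hom (mon w)) =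
     fps_const (const c) * (fps_deriv (star_hom (mon w)) + partial_ext (star_hom (mon w))
       + star_hom (mon w) * (Gz * cx))" by simp
  moreover have "partial_ext (fps_const (const c) * f) = fps_const (const c) * partial_ext f" for f
  proof -
    have "partial_deriv m (const c) = 0" for m
      using partial_deriv_rules(2)[of m c 1] partial_deriv_rules(3)[of m 1 1] by simp
    then have "partial_series (const c) = 0" by (simp add: partial_series_def fps_eq_iff)
    then show ?thesis by (simp add: partial_ext_rules(4)[of "fps_const _"] partial_ext_rules(3))
  qed
  ultimately show ?case
    by (simp add: insert_y_rules(2) star_hom_linear(3) distrib_left fps_const_const_left_commute
        mult.assoc)
next
  case (add p q)
  show ?case
    using arg_cong2[OF add, of "(+)"]
    by (simp add: insert_y_rules star_hom_linear partial_ext_rules(1) algebra_simps)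
qed

text \<open>The outer factors absorb the commutator: \<open>\<Delta>(y) = - y c\<close>, and
  \<open>c G\<close> equals the t-derivative of G plus \<Delta>(G).\<close>

lemma partial_ext_star_series:
  "cy * (star_hom (insert_y p) * Gx) - fps_deriv (cy * (star_hom p * Gx)) =
     partial_ext (cy * (star_hom p * Gx))"
proof -
  let ?s = "star_hom p" and ?c = "Gz * cx"
  have Gz: "?c = cx + fps_X * ((cx + cy) * ?c)"
    using arg_cong[OF geometric_unfold(1)[of "hx + hy"], of "\<lambda>f. f * cx"]
    by (simp only: distrib_right mult_1_left mult.assoc fps_const_hx_hy)
  \<comment> \<open>Solving \<open>c = x + t x c + t y c\<close> for the term with \<open>x\<close>
    on the left; multiplication by G on the right then yields the expression for
    \<open>c G\<close>.\<close>
  have "?c = Gx * (cx + fps_X * (cy * ?c))"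
    by (rule geometric_solve) (subst Gz, simp only: distrib_left distrib_right mult.assoc add_ac)
  then have c: "?c * Gx = Gx * cx * Gx + fps_X * (Gx * (cy * (?c * Gx)))"
    by (metis (no_types, lifting) distrib_left distrib_right fps_X_left_commute mult.assoc)
  have "cy * (star_hom (insert_y p) * Gx) + cy * (?c * (?s * Gx)) =
      cy * ((star_hom (insert_y p) + ?c * ?s) * Gx)"
    by (simp only: distrib_left distrib_right mult.assoc)
  also have "\<dots> = cy * ((fps_deriv ?s + partial_ext ?s + ?s * ?c) * Gx)"
    by (simp only: star_hom_insert_y)
  also have "\<dots> = cy * (fps_deriv ?s * Gx) + cy * (partial_ext ?s * Gx) + cy * (?s * (?c * Gx))"
    by (simp only: distrib_left distrib_right mult.assoc)
  also have "\<dots> = cy * (fps_deriv ?s * Gx) + cy * (partial_ext ?s * Gx) +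
      cy * (?s * (Gx * cx * Gx)) + fps_X * (cy * (?s * (Gx * (cy * (?c * Gx)))))"
    using arg_cong[OF c, of "\<lambda>f. cy * (?s * f)"]
    by (simp only: distrib_left fps_X_left_commute add.assoc)
  finally have insert: "cy * (star_hom (insert_y p) * Gx) = cy * (fps_deriv ?s * Gx) +
      cy * (partial_ext ?s * Gx) + cy * (?s * (Gx * cx * Gx)) +
      fps_X * (cy * (?s * (Gx * (cy * (?c * Gx))))) - cy * (?c * (?s * Gx))"
    by (simp only: eq_diff_eq)
  have deriv: "fps_deriv (cy * (?s * Gx)) = cy * (fps_deriv ?s * Gx) + cy * (?s * (Gx * cx * Gx))"
    by (simp add: fps_deriv_geometric distrib_left mult.assoc)
  have partial: "partial_ext (cy * (?s * Gx)) = cy * (partial_ext ?s * Gx) +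
      fps_X * (cy * (?s * (Gx * (cy * (?c * Gx))))) - cy * (?c * (?s * Gx))"
    by (simp add: partial_ext_rules(4)[of cy] partial_ext_rules(4)[of "star_hom p"]
        partial_ext_rules(3) partial_series_letters partial_ext_geometric distrib_left
        fps_X_left_commute mult.assoc)
  have cancel: "d + p + d' + q - r - (d + d') = p + q - r" for d p d' q r :: "ncpoly fps"
    by (simp add: algebra_simps)
  show ?thesis unfolding insert deriv partial by (rule cancel)
qed

text \<open>The factor \<open>n + 1\<close> and the shifted index in \<open>F\<close> are those of a
  t-derivative.\<close>

lemma F_eq_partial_ext: "F (hy * p) n = partial_ext (cy * (star_hom p * Gx)) $ n"
proof -
  have "inner_harmonic (ones_star k) (hy * q) = (cy * (star_hom q * Gx)) $ k" for k q
    by (simp flip: ones_star_harmonic_series)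
  then show ?thesis
    unfolding F_def inner_shuffle_hy partial_ext_star_series[symmetric]
    by (simp only: fps_sub_nth fps_deriv_nth)
qed

section \<open>Scalars, constant terms and the final substitution\<close>

lemma const_neg_one_power: "const ((- 1) ^ n) = (- 1) ^ n"
proof (induction n)
  case (Suc n)
  then show ?case using const_mult[of "- 1" "(- 1) ^ n"] by (simp add: const_minus_one)
qed (simp add: const_one)

lemma F_scale: "F (const c * v) n = const c * F v n"
  by (simp add: F_def inner_shuffle_linear_right inner_harmonic_linear_right right_diff_distrib
      mult_const_left_commute)

lemma lookup_Nil_mult_letter:
  "Poly_Mapping.lookup (p * mon [u]) [] = 0" "Poly_Mapping.lookup (mon [u] * p) [] = 0"
proof -
  show "Poly_Mapping.lookup (p * mon [u]) [] = 0"
    by (induction p rule: ncpoly_induct)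
      (simp_all add: distrib_right lookup_add mult.assoc lookup_single flip: mon_append,
       simp add: const_mon lookup_single)
  show "Poly_Mapping.lookup (mon [u] * p) [] = 0"
    by (induction p rule: ncpoly_induct)
      (simp_all add: distrib_left lookup_add mult_const_left_commute flip: mon_append,
       simp add: const_mon lookup_single)
qed

text \<open>Elements of \<open>hC\<close> have no constant term, which forces the scalar in the
  \<open>h0\<close> form to vanish.\<close>

lemma hC0_E:
  assumes "w \<in> hC0"
  obtains a where "w = hy * a"
proof -
  obtain c a where w: "w = const c + hy * a * hx"
    using assms by (auto simp: hC0_def h0_def)
  have "Poly_Mapping.lookup w [] = 0"
    using assms by (auto simp: hC0_def hC_def hx_def hy_def lookup_add lookup_Nil_mult_letter)
  moreover have "Poly_Mapping.lookup (const c) [] = c"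
    by (simp add: const_def)
  ultimately have "c = 0"
    by (simp add: w hx_def lookup_add lookup_Nil_mult_letter)
  then have "w = hy * (a * hx)" by (simp add: w const_0 mult.assoc)
  then show ?thesis by (rule that)
qed

theorem theorem5p5:
  fixes w :: ncpoly and m :: nat
  assumes "w \<in> hC0" and "m \<ge> 1"
  shows "(\<Sum>i = 1..m. (- 1) ^ (i - 1) * F (inner_harmonic (hy ^ (i - 1)) w) (m - i))
         = partial_deriv m w"
proof -
  obtain a where w: "w = hy * a" using assms(1) by (rule hC0_E)
  obtain n where m: "m = Suc n" using assms(2) by (cases m) auto
  \<comment> \<open>By \<open>ones_harmonic_series\<close>, \<open>y\<close> times coefficient
    \<open>k\<close> of \<open>b\<close> is the product of \<open>(- y)^k\<close> with
    \<open>w\<close>.\<close>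
  define b where "b = ones_hom a * (1 - fps_X * cx)"
  define S where "S = (\<lambda>p. cy * (star_hom p * Gx))"
  have summand: "(- 1) ^ k * F (inner_harmonic (hy ^ k) w) (n - k) = partial_ext (S (b $ k)) $ (n - k)" for k
  proof -
    \<comment> \<open>The sign of the summand is absorbed into the power of
      \<open>- y\<close>.\<close>
    have "(- hy) ^ k = const ((- 1) ^ k) * hy ^ k"
      by (simp add: const_neg_one_power power_minus[of hy])
    moreover have "inner_harmonic ((- hy) ^ k) w = hy * b $ k"
      using arg_cong[OF ones_harmonic_series[of a], of "\<lambda>f. f $ k"] by (simp add: w b_def)
    ultimately show ?thesis
      using F_scale[of "(- 1) ^ k" "inner_harmonic (hy ^ k) w" "n - k"]
      by (simp add: S_def inner_harmonic_linear_left flip: F_eq_partial_ext const_neg_one_power)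
  qed
  have "(\<Sum>i = 1..m. (- 1) ^ (i - 1) * F (inner_harmonic (hy ^ (i - 1)) w) (m - i))
      = (\<Sum>k = 0..n. (- 1) ^ k * F (inner_harmonic (hy ^ k) w) (n - k))"
    unfolding m One_nat_def sum.shift_bounds_cl_Suc_ivl by simp
  \<comment> \<open>The alternating sum is the convolution that defines coefficient \<open>n\<close>
    of the extension.\<close>
  also have "\<dots> = fps_extend (\<lambda>p. partial_ext (S p)) b $ n"
    by (simp add: summand fps_extend_def)
  also have "fps_extend (\<lambda>p. partial_ext (S p)) b = partial_ext (fps_extend S b)"
    unfolding partial_ext_def by (rule fps_extend_fps_extend) (rule partial_series_rules)
  also have "fps_extend S b = cy * (fps_extend star_hom b * Gx)"
    by (simp add: S_def fps_extend_mult_const_left fps_extend_mult_right)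
  \<comment> \<open>\<sigma> undoes \<phi> and fixes \<open>1 - t x\<close>, which cancels
    G.\<close>
  also have "\<dots> = fps_const w"
    by (simp add: b_def fps_extend_star_hom_mult star_hom_ones_hom fps_extend_star_hom_one_minus_X
        mult.assoc geometric_inverse w)
  finally show ?thesis by (simp add: partial_ext_rules(3) partial_series_def m)
qed

end
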